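(* For any integer $n\geqslant 2$ and any $\alpha>0$ there exists a centrally symmetric convex body $K$ in $\mathbb{R}^n$ such that $$S(K)>\alpha\,|K|^{\frac1n}\max_{\xi\in S^{n-1}}S(P_{\xi^\perp}(K))\geqslant \alpha\,|K|^{\frac1n}\max_{\xi\in S^{n-1}}S(K\cap\xi^\perp).$$
   Context: A convex body in $\mathbb{R}^n$ is a compact convex set with non-empty interior; it is centrally symmetric if $x\in K$ implies $-x\in K$. $|\cdot|$ denotes volume, $S^{n-1}$ the Euclidean unit sphere, $\xi^\perp=\{x\in\mathbb{R}^n:\langle x,\xi\rangle=0\}$, and $P_{\xi^\perp}$ the orthogonal projection onto $\xi^\perp$. $S(A)$ denotes surface area in the appropriate dimension: if $A$ is a convex body in an $m$-dimensional Euclidean space $E$ with unit ball $B_E$, then $S(A)=\lim_{t\to0^+}\frac{|A+tB_E|-|A|}{t}$ ($m$-dimensional volume); $S(P_{\xi^\perp}(K))$ and $S(K\cap\xi^\perp)$ are computed in the $(n-1)$-dimensional space $\xi^\perp$ (they equal $2$ when $n=2$). *)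

theory Defs
  imports "HOL-Analysis.Analysis"
begin

definition convex_body :: "'a::euclidean_space set \<Rightarrow> bool" where
  "convex_body K \<longleftrightarrow> compact K \<and> convex K \<and> interior K \<noteq> {}"

definition centrally_symmetric :: "'a::real_vector set \<Rightarrow> bool" where
  "centrally_symmetric K \<longleftrightarrow> (\<forall>x\<in>K. - x \<in> K)"

definition orthonormal_basis_of :: "'a::euclidean_space set \<Rightarrow> 'a set \<Rightarrow> bool" where
  "orthonormal_basis_of E B \<longleftrightarrow>
     pairwise orthogonal B \<and> (\<forall>b\<in>B. norm b = 1) \<and> span B = E"

(* Lebesgue (Borel) measure of the Euclidean space E, for a linear subspace E, regarded
   as a measure on the ambient space.  It copies the construction of lborel (see lborel_eq),
   with an orthonormal basis of E in place of Basis; by rotation invariance of Lebesgue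
   measure it does not depend on the basis selected. *)
definition lborel_subspace :: "'a::euclidean_space set \<Rightarrow> 'a measure" where
  "lborel_subspace E =
     (let B = (SOME B. orthonormal_basis_of E B)
      in distr (\<Pi>\<^sub>M b\<in>B. lborel) borel (\<lambda>f. \<Sum>b\<in>B. f b *\<^sub>R b))"

(* The volume derivative |A + t B_E| - |A| over t, as t decreases to 0, with B_E the unit
   ball of E.  For a convex body A of E, which may be lower-dimensional in the ambient
   space, the limit exists. *)
definition surface_area :: "'a::euclidean_space set \<Rightarrow> 'a set \<Rightarrow> real" where
  "surface_area E A =
     Lim (at_right 0)
       (\<lambda>t. (measure (lborel_subspace E) {a + t *\<^sub>R b | a b. a \<in> A \<and> b \<in> cball 0 1 \<inter> E}
             - measure (lborel_subspace E) A) / t)"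

definition perp :: "'a::euclidean_space \<Rightarrow> 'a set" where
  "perp \<xi> = {x. x \<bullet> \<xi> = 0}"

definition orthogonal_projection :: "'a::euclidean_space set \<Rightarrow> 'a \<Rightarrow> 'a" where
  "orthogonal_projection E x = (THE y. y \<in> E \<and> (\<forall>z\<in>E. orthogonal (x - y) z))"

(* The maximum is attained and equals m; Max is only meaningful on finite sets, and
   the supremum of an unbounded set of reals is unspecified. *)
definition is_maximum :: "('a \<Rightarrow> real) \<Rightarrow> 'a set \<Rightarrow> real \<Rightarrow> bool" where
  "is_maximum f X m \<longleftrightarrow> m \<in> f ` X \<and> (\<forall>x\<in>X. f x \<le> m)"

end

theory Submission
  imports Defs
begin

text \<open>
  The body is a thin slab \<open>K\<close> of the unit ball: the points \<open>x\<close> of the unit ball with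
  \<open>|x \<bullet> e| \<le> h\<close>, for a unit vector \<open>e\<close> and a small \<open>h > 0\<close>.  Projections and central sections of
  \<open>K\<close> lie in the unit ball of \<open>\<xi>\<^sup>\<bottom>\<close>, and both are equal to it for \<open>\<xi> = e\<close>.  Since surface area is
  monotone under inclusion of convex bodies, both maxima are attained at \<open>e\<close>, and they equal the surface
  area of the unit ball of dimension \<open>n - 1\<close>, which does not depend on \<open>h\<close>
  (\<open>surface_area_unit_cball\<close>).  As \<open>h\<close> tends to \<open>0\<close> the volume of \<open>K\<close> tends to \<open>0\<close>
  (\<open>measure_slab_tendsto_0\<close>), but the surface area of \<open>K\<close> stays above a positive constant because of the
  two flat faces (\<open>surface_area_lower_bound\<close>).  Hence the inequality holds for small \<open>h\<close>.

  The work lies in the two general facts about the surface area of a compact convex set \<open>A\<close>: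
  the limit that defines it exists (\<open>surface_area_tendsto\<close>), and it is monotone in \<open>A\<close>
  (\<open>surface_area_mono\<close>).  Both follow from one inequality: if \<open>A \<subseteq> A'\<close>, then
  \<open>|A + t B| - |A| \<le> |A' + t B| - |A'|\<close> for the unit ball \<open>B\<close> and every \<open>t \<ge> 0\<close>
  (\<open>parallel_body_increment_mono\<close>).  Monotonicity is immediate; for existence, apply the inequality
  to \<open>A \<subseteq> A + s B\<close> to see that \<open>|A + t B| - |A|\<close> is superadditive in \<open>t\<close>, so that its quotient
  by \<open>t\<close> converges at \<open>0\<close> by an argument of Fekete (\<open>superadditive_quotient_tendsto\<close>).

  The inequality itself is first proved with a segment in place of \<open>t B\<close>, where it is an elementary
  packing argument by translations (\<open>segment_increment_mono\<close>).  It passes to zonotopes, the finite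
  sums of segments, by iteration, and to the ball by approximation: the ball is the
  integral of the segments \<open>[-u, u]\<close> over its own points \<open>u\<close>, up to a factor, and the Riemann sums of this
  integral are zonotopes (\<open>zonotope_between_cballs\<close>).
\<close>

section \<open>Translation-invariant measures on a subspace\<close>

lemma compact_set_plus:
  fixes A B :: "'a::real_normed_vector set"
  assumes "compact A" "compact B"
  shows "compact (A + B)"
proof -
  have "A + B = {x + y | x y. x \<in> A \<and> y \<in> B}"
    by (auto simp: set_plus_def)
  then show ?thesis
    using compact_sums[OF assms] by simp
qed

lemma closed_segment_0: "closed_segment 0 v = (\<lambda>s. s *\<^sub>R v) ` {0..1}"
  by (auto simp: closed_segment_def)

lemma translation_image_eq_vimage: "(+) v ` A = (+) (- v :: 'a::ab_group_add) -` A"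
proof (intro set_eqI iffI)
  fix x
  assume "x \<in> (+) (- v) -` A"
  then have "v + (- v + x) \<in> (+) v ` A" by blast
  then show "x \<in> (+) v ` A" by simp
qed auto

text \<open>
  The volume argument needs nothing about the measure of \<^term>\<open>E\<close> beyond translation invariance
  and finiteness on compact sets, so it is carried out for every such measure; the measure lives
  on the ambient type because the subspaces vary with the direction \<open>\<xi>\<close>.
\<close>

locale subspace_measure =
  fixes E :: "'a::euclidean_space set" and M :: "'a measure"
  assumes subspace: "subspace E"
    and sets_eq: "sets M = sets borel"
    and compact_finite: "\<And>A. compact A \<Longrightarrow> A \<subseteq> E \<Longrightarrow> emeasure M A < \<infinity>"
    and translation_invariant: "\<And>v. v \<in> E \<Longrightarrow> distr M borel ((+) v) = M"
begin

lemma compact_sets: "compact A \<Longrightarrow> A \<in> sets M"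
  by (simp add: sets_eq borel_compact)

lemma compact_fmeasurable: "compact A \<Longrightarrow> A \<subseteq> E \<Longrightarrow> A \<in> fmeasurable M"
  by (intro fmeasurableI compact_sets compact_finite)

lemma translation_measurable: "(+) v \<in> borel_measurable M"
proof -
  have "(+) v \<in> borel_measurable borel"
    by (intro borel_measurable_continuous_onI continuous_intros)
  then show ?thesis
    by (simp add: measurable_cong_sets[OF sets_eq refl])
qed

lemma emeasure_translation:
  assumes "v \<in> E" "A \<in> sets M"
  shows "emeasure M ((+) v ` A) = emeasure M A"
proof -
  have "emeasure M A = emeasure (distr M borel ((+) (- v))) A"
    using translation_invariant[of "- v"] assms subspace by (simp add: subspace_neg)
  moreover have "\<dots> = emeasure M ((+) (- v) -` A \<inter> space M)"
    using assms by (intro emeasure_distr translation_measurable) (auto simp: sets_eq)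
  ultimately show ?thesis
    using sets_eq_imp_space_eq[OF sets_eq] by (simp add: translation_image_eq_vimage)
qed

lemma translation_sets:
  assumes "A \<in> sets M"
  shows "(+) v ` A \<in> sets M"
proof -
  have "(+) (- v) -` A \<inter> space M \<in> sets M"
  proof (rule measurable_sets)
    show "(+) (- v) \<in> borel_measurable M" by (rule translation_measurable)
    show "A \<in> sets borel" using assms by (simp add: sets_eq)
  qed
  then show ?thesis
    using sets_eq_imp_space_eq[OF sets_eq] by (simp add: translation_image_eq_vimage)
qed

lemma set_plus_subset: "A \<subseteq> E \<Longrightarrow> B \<subseteq> E \<Longrightarrow> A + B \<subseteq> E"
  using subspace_add[OF subspace] by (auto simp: set_plus_def)

text \<open>
  Adding a segment \<open>[0, v]\<close> to a convex body enlarges it by (length of \<open>v\<close>) times (volume of the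
  projection along \<open>v\<close>), which is monotone in the body.  Fubini is avoided as follows.  On every
  line parallel to \<open>v\<close> that meets \<open>A\<close>, the difference of \<open>A + [0, v]\<close> and \<open>A\<close> is a half-open
  segment of length \<open>v\<close> by convexity, so it meets each class modulo \<open>\<int> v\<close> exactly once;
  the corresponding difference for \<open>A'\<close> meets each such class at least once.  Cutting the first
  difference into countably many pieces and translating the pieces by multiples of \<open>v\<close> therefore
  packs it disjointly into the second.
\<close>

lemma segment_increment_mono:
  assumes A: "compact A" "convex A" and A': "compact A'" "A \<subseteq> A'" "A' \<subseteq> E" and v: "v \<in> E"
  shows "measure M (A + closed_segment 0 v) - measure M A
    \<le> measure M (A' + closed_segment 0 v) - measure M A'"
proof (cases "v = 0")
  case True
  then show ?thesis by (simp add: set_zero)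
next
  case False
  define S where "S = closed_segment 0 v"
  define G where "G = (A + S) - A"
  define G' where "G' = (A' + S) - A'"
  have S: "compact S" "S \<subseteq> E" "0 \<in> S"
    using v subspace by (auto simp: S_def closed_segment_0 subspace_scale image_iff
        intro!: compact_continuous_image continuous_intros bexI[of _ 0])
  have fm: "A \<in> fmeasurable M" "A' \<in> fmeasurable M" "A + S \<in> fmeasurable M" "A' + S \<in> fmeasurable M"
    using A A' S compact_fmeasurable set_plus_subset compact_set_plus by (metis subset_trans)+
  have sub: "A \<subseteq> A + S" "A' \<subseteq> A' + S"
    using set_zero_plus2[OF S(3), of A] set_zero_plus2[OF S(3), of A'] by (simp_all add: add.commute)
  have G: "G \<in> fmeasurable M" and G': "G' \<in> fmeasurable M"
    using fm by (auto simp: G_def G'_def)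
  \<comment> \<open>The points of \<open>G\<close> whose translate by \<open>k v\<close> lies in \<open>G'\<close>.\<close>
  define X where "X k = G \<inter> (+) (real_of_int (- k) *\<^sub>R v) ` G'" for k :: int
  have X: "X k \<in> sets M" for k
    unfolding X_def using G G' by (intro sets.Int translation_sets) (simp_all add: fmeasurable_def)
  have G_UN: "G \<subseteq> (\<Union>k. X k)"
  proof
    fix x assume x: "x \<in> G"
    then obtain a s where a: "a \<in> A" and s: "0 \<le> s" "s \<le> 1" and xa: "x = a + s *\<^sub>R v"
      by (auto simp: G_def S_def closed_segment_0 set_plus_def)
    \<comment> \<open>The parameters at which the line through \<open>x\<close> lies in \<open>A'\<close>; just beyond the last of them begins a full period inside \<open>G'\<close>.\<close>
    define R where "R = {r. a + r *\<^sub>R v \<in> A'}"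
    have "compact R"
    proof -
      have "closed R"
      proof -
        have "R = (\<lambda>r. a + r *\<^sub>R v) -` A'" by (auto simp: R_def)
        moreover have "closed ((\<lambda>r. a + r *\<^sub>R v) -` A')"
          using compact_imp_closed[OF A'(1)] by (intro closed_vimage continuous_intros)
        ultimately show ?thesis by simp
      qed
      moreover have "bounded R"
      proof -
        obtain b where b: "\<And>y. y \<in> A' \<Longrightarrow> norm y \<le> b"
          using compact_imp_bounded[OF A'(1)] by (auto simp: bounded_iff)
        have "norm r \<le> (b + norm a) / norm v" if "r \<in> R" for r
        proof -
          have "norm (r *\<^sub>R v) \<le> norm (a + r *\<^sub>R v) + norm a"
            by (metis add_diff_cancel_left' norm_triangle_ineq4)
          also have "\<dots> \<le> b + norm a" using b that by (simp add: R_def)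
          finally show ?thesis using False by (simp add: field_simps)
        qed
        then show ?thesis by (auto simp: bounded_iff)
      qed
      ultimately show ?thesis by (simp add: compact_eq_bounded_closed)
    qed
    moreover have "R \<noteq> {}" using a A' by (auto simp: R_def intro!: exI[of _ 0])
    ultimately obtain b where b: "b \<in> R" "\<And>r. r \<in> R \<Longrightarrow> r \<le> b"
      by (metis compact_attains_sup)
    define k where "k = \<lfloor>b - s\<rfloor> + 1"
    have k: "b < s + k" "s + k \<le> b + 1" by (auto simp: k_def) linarith+
    have "x + real_of_int k *\<^sub>R v = (a + b *\<^sub>R v) + (s + k - b) *\<^sub>R v"
      by (simp add: xa algebra_simps)
    moreover have "\<dots> \<in> A' + S"
      using b k by (intro set_plus_intro) (auto simp: R_def S_def closed_segment_0)
    moreover have "x + real_of_int k *\<^sub>R v \<notin> A'"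
      using b(2)[of "s + k"] k by (auto simp: R_def xa algebra_simps)
    ultimately have "x + real_of_int k *\<^sub>R v \<in> G'"
      by (simp add: G'_def)
    then have "x \<in> X k"
      using x by (auto simp: X_def image_iff intro!: bexI[of _ "x + real_of_int k *\<^sub>R v"])
    then show "x \<in> (\<Union>k. X k)" by blast
  qed
  have G_unique: False if shifts: "x \<in> G" "x + real_of_int k *\<^sub>R v \<in> G" "k \<ge> 1" for x k
  proof -
    obtain a s where a: "a \<in> A" "0 \<le> s" "s \<le> 1" and xa: "x + real_of_int k *\<^sub>R v = a + s *\<^sub>R v"
      using shifts(2) unfolding G_def S_def closed_segment_0 by (auto elim!: set_plus_elim)
    obtain a' s' where a': "a' \<in> A" "0 \<le> s'" "s' \<le> 1" and xa': "x = a' + s' *\<^sub>R v"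
      using shifts(1) unfolding G_def S_def closed_segment_0 by (auto elim!: set_plus_elim)
    define q where "q = s' + (k - s)"
    have k: "real_of_int k \<ge> 1" using that by simp
    have q: "q \<ge> s'" "q \<ge> 0" using k a a' by (auto simp: q_def)
    have aq: "a = a' + q *\<^sub>R v"
      using xa xa' by (simp add: q_def algebra_simps)
    \<comment> \<open>The point \<open>x\<close> lies between the points \<open>a'\<close> and \<open>a\<close> of \<open>A\<close>.\<close>
    have "x \<in> A"
    proof (cases "q = 0")
      case True
      then show ?thesis using q a' xa' by simp
    next
      case False
      have "x = (1 - s' / q) *\<^sub>R a' + (s' / q) *\<^sub>R a"
        using False by (simp add: xa' aq algebra_simps)
      moreover have "\<dots> \<in> A"
        using A(2) a(1) a'(1,2) q False by (intro convexD) auto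
      ultimately show ?thesis by simp
    qed
    then show False using that by (simp add: G_def)
  qed
  define Y where "Y k = (+) (real_of_int k *\<^sub>R v) ` X k" for k
  have kv: "real_of_int k *\<^sub>R v \<in> E" for k using v subspace by (simp add: subspace_scale)
  have Y: "Y k \<in> sets M" for k
    using X translation_sets by (auto simp: Y_def)
  have Y_sub: "Y k \<subseteq> G'" for k by (auto simp: Y_def X_def)
  have Y_disj: "Y k \<inter> Y l = {}" if "k < l" for k l
  proof (rule ccontr)
    assume "Y k \<inter> Y l \<noteq> {}"
    then obtain x y where "x \<in> X k" "y \<in> X l" "real_of_int k *\<^sub>R v + x = real_of_int l *\<^sub>R v + y"
      by (auto simp: Y_def)
    then have "y \<in> G" "y + real_of_int (l - k) *\<^sub>R v \<in> G"
      by (auto simp: X_def algebra_simps)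
    then show False using G_unique[of y "l - k"] that by simp
  qed
  have "emeasure M G \<le> emeasure M (\<Union>n. X (int_decode n))"
  proof (rule emeasure_mono)
    show "G \<subseteq> (\<Union>n. X (int_decode n))"
    proof
      fix x assume "x \<in> G"
      then obtain k where "x \<in> X k" using G_UN by blast
      then have "x \<in> X (int_decode (int_encode k))" by simp
      then show "x \<in> (\<Union>n. X (int_decode n))" by blast
    qed
  qed (use X in auto)
  also have "\<dots> \<le> (\<Sum>n. emeasure M (X (int_decode n)))"
    using X by (intro emeasure_subadditive_countably) auto
  also have "\<dots> = (\<Sum>n. emeasure M (Y (int_decode n)))"
    by (simp add: Y_def emeasure_translation[OF kv X])
  also have "\<dots> = emeasure M (\<Union>n. Y (int_decode n))"
  proof (rule suminf_emeasure)
    show "disjoint_family (\<lambda>n. Y (int_decode n))"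
      unfolding disjoint_family_on_def
    proof (intro ballI impI)
      fix m n :: nat assume "m \<noteq> n"
      then have "int_decode m < int_decode n \<or> int_decode n < int_decode m"
        using int_decode_eq linorder_neq_iff by blast
      then show "Y (int_decode m) \<inter> Y (int_decode n) = {}"
        using Y_disj by blast
    qed
  qed (use Y in auto)
  also have "\<dots> \<le> emeasure M G'"
    using Y_sub G' by (intro emeasure_mono) (auto simp: fmeasurable_def)
  finally have "measure M G \<le> measure M G'"
    unfolding measure_def using G' by (intro enn2real_mono) (auto simp: fmeasurable_def)
  moreover have "measure M G = measure M (A + S) - measure M A" "measure M G' = measure M (A' + S) - measure M A'"
    unfolding G_def G'_def using fm sub by (auto intro!: measurable_measure_Diff simp: fmeasurable_def)
  ultimately show ?thesis by (simp add: S_def)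
qed

end

section \<open>Rotation invariance of Lebesgue measure\<close>

text \<open>
  The image measure \<open>N\<close> is translation invariant and agrees with Lebesgue measure on balls.  Two
  translation-invariant measures are proportional: integrate \<open>1\<^sub>B(x) 1\<^sub>A(x + y)\<close> over \<open>x\<close> for
  the one and \<open>y\<close> for the other, where \<open>B\<close> is a centred ball.  Integrating first over \<open>y\<close> gives
  \<open>|B| N(A)\<close>; substituting \<open>x - y\<close> for \<open>x\<close> first and using that \<open>B = -B\<close> gives \<open>N(B) |A|\<close>.
\<close>

lemma lborel_orthogonal_transformation:
  fixes T :: "'a::euclidean_space \<Rightarrow> 'a"
  assumes T: "orthogonal_transformation T"
  shows "distr lborel borel T = lborel"
proof (rule measure_eqI)
  have lin: "linear T" and norm_T: "\<And>x. norm (T x) = norm x"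
    using T by (auto simp: orthogonal_transformation)
  have meas_T: "T \<in> borel_measurable borel"
    using lin by (simp add: borel_measurable_continuous_onI linear_continuous_on linear_conv_bounded_linear)
  fix A assume "A \<in> sets (distr lborel borel T)"
  then have A[measurable]: "A \<in> sets borel" by simp
  define N where "N = distr lborel borel T"
  have sets_N[measurable_cong]: "sets N = sets borel" by (simp add: N_def)
  have N_ball: "emeasure N (cball 0 r) = emeasure lborel (cball (0::'a) r)" for r
  proof -
    have "T -` cball 0 r = cball (0::'a) r" by (auto simp: norm_T)
    then show ?thesis using meas_T by (simp add: N_def emeasure_distr)
  qed
  have ball_finite: "emeasure lborel (cball (0::'a) r) \<noteq> top" for r
    using emeasure_lborel_cball_finite[of "0::'a" r] by auto
  interpret N: sigma_finite_measure N
  proof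
    have "(\<Union>n. cball (0::'a) (real n)) = UNIV"
      by (auto simp: real_arch_simple)
    then show "\<exists>F. countable F \<and> F \<subseteq> sets N \<and> \<Union>F = space N \<and> (\<forall>a\<in>F. emeasure N a \<noteq> \<infinity>)"
      by (intro exI[of _ "range (\<lambda>n. cball 0 (real n))"])
        (auto simp: N_ball ball_finite sets_eq_imp_space_eq[OF sets_N] sets_N)
  qed
  interpret pair_sigma_finite lborel N ..
  have N_shift: "emeasure N ((+) x -` A) = emeasure N A" if [measurable]: "A \<in> sets borel" for x A
  proof -
    obtain y where y: "T y = x" using orthogonal_transformation_surj[OF T] by (metis surjD)
    have "emeasure N ((+) x -` A) = emeasure lborel ((+) y -` (T -` A))"
      using meas_T measurable_sets[OF meas_T that]
      by (simp add: N_def emeasure_distr measurable_sets_borel vimage_def linear_add[OF lin] y)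
    also have "\<dots> = emeasure (distr lborel borel ((+) y)) (T -` A)"
      using measurable_sets[OF meas_T that] by (subst emeasure_distr) auto
    also have "distr lborel borel ((+) y) = lborel"
      using lborel_affine[of 1 y] by (simp add: density_1)
    finally show ?thesis using meas_T by (simp add: N_def emeasure_distr)
  qed
  have shift_sets: "(+) x -` A \<in> sets borel" if "A \<in> sets borel" for x :: 'a and A
    using measurable_sets[of "(+) x" borel borel A] that by simp
  have lborel_shift: "distr lborel borel ((+) y) = lborel" for y :: 'a
    using lborel_affine[of 1 y] by (simp add: density_1)
  define B where "B = cball (0::'a) 1"
  have [measurable]: "B \<in> sets borel" by (simp add: B_def)
  have "emeasure lborel B * emeasure N A
      = (\<integral>\<^sup>+x. indicator B x * (\<integral>\<^sup>+y. indicator ((+) x -` A) y \<partial>N) \<partial>lborel)"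
    by (simp add: nn_integral_indicator shift_sets sets_N N_shift nn_integral_multc mult.commute)
  also have "\<dots> = (\<integral>\<^sup>+x. \<integral>\<^sup>+y. indicator B x * indicator A (x + y) \<partial>N \<partial>lborel)"
    by (intro nn_integral_cong, subst nn_integral_cmult[symmetric]) (auto simp: sets_N shift_sets indicator_def intro!: nn_integral_cong)
  also have "\<dots> = (\<integral>\<^sup>+y. \<integral>\<^sup>+x. indicator B x * indicator A (x + y) \<partial>lborel \<partial>N)"
    by (intro Fubini'[symmetric]) measurable
  also have "\<dots> = (\<integral>\<^sup>+y. \<integral>\<^sup>+x. indicator B (- y + x) * indicator A x \<partial>lborel \<partial>N)"
  proof (rule nn_integral_cong)
    fix y :: 'a
    have "(\<integral>\<^sup>+x. indicator B x * indicator A (x + y) \<partial>lborel)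
      = (\<integral>\<^sup>+x. indicator B x * indicator A (x + y) \<partial>distr lborel borel ((+) (- y)))"
      by (simp only: lborel_shift)
    also have "\<dots> = (\<integral>\<^sup>+x. indicator B (- y + x) * indicator A x \<partial>lborel)"
      by (subst nn_integral_distr) auto
    finally show "(\<integral>\<^sup>+x. indicator B x * indicator A (x + y) \<partial>lborel)
      = (\<integral>\<^sup>+x. indicator B (- y + x) * indicator A x \<partial>lborel)" .
  qed
  also have "\<dots> = (\<integral>\<^sup>+x. \<integral>\<^sup>+y. indicator B (- y + x) * indicator A x \<partial>N \<partial>lborel)"
    by (intro Fubini') measurable
  also have "\<dots> = (\<integral>\<^sup>+x. \<integral>\<^sup>+y. indicator ((+) (- x) -` B) y * indicator A x \<partial>N \<partial>lborel)"
    by (intro nn_integral_cong) (auto simp: indicator_def B_def dist_norm norm_minus_commute)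
  also have "\<dots> = (\<integral>\<^sup>+x. emeasure N B * indicator A x \<partial>lborel)"
    by (intro nn_integral_cong, subst nn_integral_multc) (auto simp: sets_N N_shift shift_sets)
  also have "\<dots> = emeasure lborel B * emeasure lborel A"
    by (simp add: nn_integral_cmult B_def N_ball)
  finally have "emeasure lborel B * emeasure N A = emeasure lborel B * emeasure lborel A" .
  moreover have "emeasure lborel B \<noteq> 0" "emeasure lborel B \<noteq> \<infinity>"
    using less_imp_neq[OF unit_ball_vol_pos, of "real DIM('a)"]
    by (auto simp: B_def emeasure_cball)
  ultimately show "emeasure (distr lborel borel T) A = emeasure lborel A"
    by (simp add: ennreal_mult_cancel_left N_def)
qed simp

section \<open>Zonotopes and the Euclidean ball\<close>

primrec zonotope :: "'a::euclidean_space list \<Rightarrow> 'a set" where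
  "zonotope [] = {0}"
| "zonotope (w # ws) = closed_segment (- w) w + zonotope ws"

lemma compact_zonotope: "compact (zonotope ws)"
  by (induction ws) (simp_all add: compact_set_plus)

lemma convex_zonotope: "convex (zonotope ws)"
  by (induction ws) (simp_all add: convex_set_plus)

lemma zonotope_subset:
  assumes "subspace E" "set ws \<subseteq> E"
  shows "zonotope ws \<subseteq> E"
  using assms(2)
proof (induction ws)
  case (Cons w ws)
  then have "closed_segment (- w) w \<subseteq> E"
    using assms(1) by (intro closed_segment_subset) (auto simp: subspace_neg subspace_imp_convex)
  with Cons show ?case
    using subspace_add[OF assms(1)] by (fastforce elim!: set_plus_elim)
qed (use subspace_0[OF assms(1)] in simp)

lemma zonotope_linear_image:
  assumes "linear f"
  shows "f ` zonotope ws = zonotope (map f ws)"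
proof (induction ws)
  case (Cons w ws)
  have "f ` (A + B) = f ` A + f ` B" for A B
    by (force simp: set_plus_def linear_add[OF assms] image_iff)
  then show ?case
    using Cons closed_segment_linear_image[OF assms, of "- w" w] by (simp add: linear_neg[OF assms])
qed (simp add: linear_0[OF assms])

lemma zonotope_inner_le:
  "z \<in> zonotope ws \<Longrightarrow> a \<bullet> z \<le> (\<Sum>w\<leftarrow>ws. \<bar>a \<bullet> w\<bar>)"
proof (induction ws arbitrary: z)
  case (Cons w ws)
  then obtain s y where s: "0 \<le> s" "s \<le> 1" and y: "y \<in> zonotope ws"
    and z: "z = ((1 - s) *\<^sub>R (- w) + s *\<^sub>R w) + y"
    by (auto simp: closed_segment_def elim!: set_plus_elim)
  have "a \<bullet> z = (2 * s - 1) * (a \<bullet> w) + a \<bullet> y"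
    by (simp add: z inner_add_right inner_diff_right algebra_simps)
  also have "(2 * s - 1) * (a \<bullet> w) \<le> \<bar>2 * s - 1\<bar> * \<bar>a \<bullet> w\<bar>"
    by (metis abs_ge_self abs_mult)
  also have "\<dots> \<le> 1 * \<bar>a \<bullet> w\<bar>"
    using s by (intro mult_right_mono) auto
  finally show ?case using Cons.IH[OF y] by simp
qed simp

text \<open>
  Together with the preceding bound: the support function of the zonotope of \<open>ws\<close> in direction \<open>a\<close>
  is the sum of the numbers \<open>|a \<bullet> w|\<close>.
\<close>

lemma zonotope_inner_attained:
  "\<exists>z\<in>zonotope ws. a \<bullet> z = (\<Sum>w\<leftarrow>ws. \<bar>a \<bullet> w\<bar>)"
proof (induction ws)
  case (Cons w ws)
  then obtain z where z: "z \<in> zonotope ws" "a \<bullet> z = (\<Sum>w\<leftarrow>ws. \<bar>a \<bullet> w\<bar>)" by blast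
  define y where "y = (if a \<bullet> w \<ge> 0 then w else - w)"
  have "y + z \<in> zonotope (w # ws)"
    unfolding zonotope.simps using z by (intro set_plus_intro) (auto simp: y_def)
  moreover have "a \<bullet> (y + z) = (\<Sum>w\<leftarrow>w # ws. \<bar>a \<bullet> w\<bar>)"
    using z by (simp add: y_def inner_add_right)
  ultimately show ?case by blast
qed simp

text \<open>
  Inclusion of closed convex sets is comparison of support functions; for balls inside a zonotope
  this is the separation of a missing point by a hyperplane.
\<close>

lemma cball_subset_zonotope:
  assumes "\<And>a. r * norm a \<le> (\<Sum>w\<leftarrow>ws. \<bar>a \<bullet> w\<bar>)"
  shows "cball 0 r \<subseteq> zonotope ws"
proof
  fix y :: 'a assume y: "y \<in> cball 0 r"
  show "y \<in> zonotope ws"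
  proof (rule ccontr)
    assume "y \<notin> zonotope ws"
    then obtain a b where ab: "a \<bullet> y < b" "\<And>z. z \<in> zonotope ws \<Longrightarrow> b < a \<bullet> z"
      using separating_hyperplane_closed_point[OF convex_zonotope compact_imp_closed[OF compact_zonotope]]
      by metis
    obtain z where "z \<in> zonotope ws" "(- a) \<bullet> z = (\<Sum>w\<leftarrow>ws. \<bar>(- a) \<bullet> w\<bar>)"
      using zonotope_inner_attained by blast
    then have "r * norm a < - (a \<bullet> y)"
      using ab(1) ab(2)[of z] assms[of "- a"] by simp
    also have "\<dots> \<le> norm a * norm y"
      using norm_cauchy_schwarz[of "- a" y] by simp
    also have "\<dots> \<le> norm a * r" using y by (intro mult_left_mono) auto
    finally show False by simp
  qed
qed

lemma zonotope_subset_cball: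
  assumes "r \<ge> 0"
  assumes "\<And>a. (\<Sum>w\<leftarrow>ws. \<bar>a \<bullet> w\<bar>) \<le> r * norm a"
  shows "zonotope ws \<subseteq> cball 0 r"
proof
  fix z assume "z \<in> zonotope ws"
  then have "norm z * norm z \<le> r * norm z"
    using zonotope_inner_le[of z ws z] assms(2)[of z] by (simp add: dot_square_norm power2_eq_square)
  then show "z \<in> cball 0 r"
    using assms(1) by (cases "z = 0") auto
qed

text \<open>
  The support function of the integral, over the points \<open>u\<close> of the unit ball, of the segments \<open>[-u, u]\<close>.  By rotation invariance that zonoid is a ball, and its Riemann
  sums are zonotopes.
\<close>

definition ball_moment :: "'a::euclidean_space \<Rightarrow> real" where
  "ball_moment a = (LINT u:cball 0 1|lborel. \<bar>a \<bullet> u\<bar>)"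

lemma set_integrable_abs_inner:
  fixes a :: "'a::euclidean_space"
  shows "set_integrable lborel (cball 0 1) (\<lambda>u. \<bar>a \<bullet> u\<bar>)"
  unfolding set_integrable_def
  by (rule borel_integrable_compact) (simp, intro continuous_intros)

lemma ball_moment_rotate:
  fixes T :: "'a::euclidean_space \<Rightarrow> 'a"
  assumes T: "orthogonal_transformation T"
  shows "ball_moment (T a) = ball_moment a"
proof -
  have norm_T: "norm (T x) = norm x" and inner_T: "T x \<bullet> T y = x \<bullet> y" for x y
    using T by (auto simp: orthogonal_transformation_def orthogonal_transformation_norm[OF T])
  have meas_T: "T \<in> borel_measurable borel"
    using orthogonal_transformation_linear[OF T]
    by (simp add: borel_measurable_continuous_onI linear_continuous_on linear_conv_bounded_linear)
  have "ball_moment (T a) = (LINT u|distr lborel borel T. indicator (cball 0 1) u *\<^sub>R \<bar>T a \<bullet> u\<bar>)"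
    by (simp add: ball_moment_def set_lebesgue_integral_def lborel_orthogonal_transformation[OF T])
  also have "\<dots> = (LINT u|lborel. indicator (cball 0 1) (T u) *\<^sub>R \<bar>T a \<bullet> T u\<bar>)"
    using meas_T borel_measurable_integrable[OF set_integrable_abs_inner[of "T a", unfolded set_integrable_def]]
    by (intro integral_distr) simp_all
  also have "\<dots> = ball_moment a"
    by (simp add: ball_moment_def set_lebesgue_integral_def inner_T indicator_def norm_T)
  finally show ?thesis .
qed

lemma reflection_exists:
  fixes x y :: "'a::euclidean_space"
  assumes "norm x = norm y"
  obtains T where "orthogonal_transformation T" "T x = y"
proof (cases "x = y")
  case True
  with that[of "\<lambda>x. x"] show ?thesis by (simp add: orthogonal_transformation_id)
next
  case False
  define u where "u = x - y"
  define T where "T z = z - (2 * (z \<bullet> u) / (u \<bullet> u)) *\<^sub>R u" for z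
  have u: "u \<bullet> u \<noteq> 0" using False by (simp add: u_def)
  have "T z \<bullet> T w = z \<bullet> w" for z w
    using u by (simp add: T_def inner_diff_left inner_diff_right field_simps inner_commute)
  moreover have "linear T"
    by (rule linearI) (simp_all add: T_def inner_add_left algebra_simps add_divide_distrib)
  moreover have "T x = y"
  proof -
    have "x \<bullet> x = y \<bullet> y" using assms by (simp add: norm_eq)
    then have "2 * (x \<bullet> u) = u \<bullet> u"
      by (simp add: u_def inner_diff_left inner_diff_right inner_commute)
    then show ?thesis using u by (simp add: T_def) (simp add: u_def)
  qed
  ultimately show ?thesis
    using that[of T] by (simp add: orthogonal_transformation_def)
qed

text \<open>
  Any two vectors of equal norm are exchanged by a reflection, so the moment depends on the norm
  alone; it is positive because a hyperplane is a null set.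
\<close>

lemma ball_moment_eq:
  "\<exists>c>0. \<forall>a::'a::euclidean_space. ball_moment a = c * norm a"
proof -
  obtain e :: 'a where e: "norm e = 1"
    using vector_choose_size[of 1] by auto
  have scale: "ball_moment (r *\<^sub>R b) = \<bar>r\<bar> * ball_moment b" for r and b :: 'a
    by (simp add: ball_moment_def abs_mult)
  have eq: "ball_moment a = ball_moment e * norm a" for a :: 'a
  proof -
    obtain T where "orthogonal_transformation T" "T (norm a *\<^sub>R e) = a"
      using reflection_exists[of "norm a *\<^sub>R e" a] e by auto
    then show ?thesis
      using ball_moment_rotate[of T "norm a *\<^sub>R e"] scale[of "norm a" e] by simp
  qed
  have "ball_moment e \<noteq> 0"
  proof
    assume "ball_moment e = 0"
    then have "AE u in lborel. indicator (cball 0 1) u *\<^sub>R \<bar>e \<bullet> u\<bar> = 0"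
      using set_integrable_abs_inner[of e, unfolded set_integrable_def]
      unfolding ball_moment_def set_lebesgue_integral_def
      by (subst (asm) integral_nonneg_eq_0_iff_AE) auto
    then have "AE u in lborel. u \<notin> cball (0::'a) 1"
    proof -
      have "AE u in lborel. e \<bullet> u \<noteq> 0"
      proof -
        have "{u. e \<bullet> u = 0} \<in> null_sets lebesgue"
          using negligible_hyperplane[of e 0] e negligible_iff_null_sets by fastforce
        moreover have "{u. e \<bullet> u = 0} \<in> sets lborel"
          by (simp add: borel_closed closed_hyperplane)
        ultimately have "{u. e \<bullet> u = 0} \<in> null_sets lborel"
          by (simp add: null_sets_completion_iff)
        then show ?thesis by (rule AE_I') auto
      qed
      with \<open>AE u in lborel. indicator (cball 0 1) u *\<^sub>R \<bar>e \<bullet> u\<bar> = 0\<close> show ?thesis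
        by eventually_elim (auto simp: indicator_def split: if_splits)
    qed
    then have "emeasure lborel (cball (0::'a) 1) = 0"
      by (subst (asm) AE_iff_measurable[of "cball 0 1"]) auto
    then show False
      using unit_ball_vol_pos[of "real DIM('a)"] by (simp add: emeasure_cball)
  qed
  moreover have "ball_moment e \<ge> 0"
    by (auto simp: ball_moment_def set_lebesgue_integral_def)
  ultimately have "ball_moment e > 0" by simp
  with eq show ?thesis by blast
qed

text \<open>
  The sum is a Riemann sum of the moment: cut the ball into finitely many pieces, each inside a ball of radius \<open>d\<close>, and replace \<open>u\<close> on
  each piece by one point.  The integrand is Lipschitz in \<open>u\<close> with constant \<open>norm a\<close>, so the error
  is uniform over the directions.
\<close>

lemma ball_moment_approx:
  fixes d :: real
  assumes "d > 0"
  obtains ws :: "'a::euclidean_space list"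
  where "\<And>a. \<bar>ball_moment a - (\<Sum>w\<leftarrow>ws. \<bar>a \<bullet> w\<bar>)\<bar> \<le> d * measure lborel (cball (0::'a) 1) * norm a"
proof -
  have "compact (cball (0::'a) 1)" by simp
  then obtain P where P: "finite P" "cball (0::'a) 1 \<subseteq> (\<Union>x\<in>P. ball x d)"
  proof (rule compactE_image)
    show "cball (0::'a) 1 \<subseteq> (\<Union>x\<in>UNIV. ball x d)" using assms by auto (metis dist_self)
  qed auto
  obtain xs where xs: "set xs = P" using finite_list[OF P(1)] by blast
  define n where "n = length xs"
  \<comment> \<open>Disjoint pieces: each point of the ball goes to the first small ball that contains it.\<close>
  define D where "D i = cball (0::'a) 1 \<inter> (ball (xs ! i) d - (\<Union>j<i. ball (xs ! j) d))" for i
  define m where "m i = measure lborel (D i)" for i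
  have D_sets: "D i \<in> sets lborel" for i by (auto simp: D_def)
  have D_sub: "D i \<subseteq> cball 0 1" "D i \<subseteq> ball (xs ! i) d" for i by (auto simp: D_def)
  have D_fin: "emeasure lborel (D i) \<noteq> \<infinity>" for i
    using emeasure_mono[OF D_sub(1)[of i], of lborel] emeasure_lborel_cball_finite[of "0::'a" 1] by auto
  have D_disj: "disjoint_family_on D {..<n}"
  proof -
    have "D i \<inter> D j = {}" if "i < j" for i j using that by (auto simp: D_def)
    then show ?thesis by (auto simp: disjoint_family_on_def) (metis disjoint_iff linorder_neqE_nat)
  qed
  have D_UN: "(\<Union>i\<in>{..<n}. D i) = cball 0 1"
  proof
    show "cball 0 1 \<subseteq> (\<Union>i\<in>{..<n}. D i)"
    proof
      fix u :: 'a assume u: "u \<in> cball 0 1"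
      then have ex: "\<exists>i. i < n \<and> u \<in> ball (xs ! i) d"
        using P(2) by (fastforce simp: xs[symmetric] in_set_conv_nth n_def)
      define i where "i = (LEAST i. i < n \<and> u \<in> ball (xs ! i) d)"
      have i: "i < n" "u \<in> ball (xs ! i) d" using LeastI_ex[OF ex] by (auto simp: i_def)
      have "u \<notin> ball (xs ! j) d" if "j < i" for j
        using not_less_Least[of j "\<lambda>i. i < n \<and> u \<in> ball (xs ! i) d"] that i by (auto simp: i_def)
      with u i show "u \<in> (\<Union>i\<in>{..<n}. D i)" by (auto simp: D_def)
    qed
  qed (auto simp: D_def)
  show thesis
  proof (rule that)
    fix a :: 'a
    have int: "set_integrable lborel (D i) (\<lambda>u. \<bar>a \<bullet> u\<bar>)" for i
      using set_integrable_subset[OF set_integrable_abs_inner D_sets D_sub(1)] .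
    have const: "set_integrable lborel (D i) (\<lambda>_. c)" for i and c :: real
      using D_fin[of i] D_sets[of i] by (simp add: set_integrable_def less_top)
    have split: "ball_moment a = (\<Sum>i<n. LINT u:D i|lborel. \<bar>a \<bullet> u\<bar>)"
      unfolding ball_moment_def D_UN[symmetric]
      by (intro set_integral_finite_Union D_disj int D_sets) simp
    have m_sum: "(\<Sum>i<n. m i) = measure lborel (cball (0::'a) 1)"
      unfolding m_def D_UN[symmetric]
      by (intro measure_UNION'[symmetric]) (use D_disj D_sets D_fin in \<open>auto simp: fmeasurable_def less_top pairwise_def disjoint_family_on_def disjnt_def\<close>)
    have piece: "\<bar>(LINT u:D i|lborel. \<bar>a \<bullet> u\<bar>) - m i * \<bar>a \<bullet> xs ! i\<bar>\<bar> \<le> m i * (d * norm a)" for i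
    proof -
      have near: "\<bar>\<bar>a \<bullet> u\<bar> - \<bar>a \<bullet> xs ! i\<bar>\<bar> \<le> d * norm a" if "u \<in> D i" for u
      proof -
        have "\<bar>\<bar>a \<bullet> u\<bar> - \<bar>a \<bullet> xs ! i\<bar>\<bar> \<le> \<bar>a \<bullet> (u - xs ! i)\<bar>"
          unfolding inner_diff_right by linarith
        also have "\<dots> \<le> norm a * norm (u - xs ! i)" by (rule Cauchy_Schwarz_ineq2)
        also have "\<dots> \<le> norm a * d"
          using that D_sub(2)[of i] by (intro mult_left_mono) (auto simp: dist_norm norm_minus_commute less_imp_le)
        finally show ?thesis by (simp add: mult.commute)
      qed
      have "(LINT u:D i|lborel. \<bar>a \<bullet> u\<bar>) \<le> (LINT u:D i|lborel. \<bar>a \<bullet> xs ! i\<bar> + d * norm a)"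
        using near by (intro set_integral_mono int const) (force simp: abs_le_iff)
      moreover have "(LINT u:D i|lborel. \<bar>a \<bullet> xs ! i\<bar> - d * norm a) \<le> (LINT u:D i|lborel. \<bar>a \<bullet> u\<bar>)"
        using near by (intro set_integral_mono int const) (force simp: abs_le_iff)
      ultimately show ?thesis
        using D_fin[of i] D_sets[of i] by (simp add: set_integral_const m_def abs_le_iff algebra_simps)
    qed
    let ?ws = "map (\<lambda>i. m i *\<^sub>R xs ! i) [0..<n]"
    have "(\<Sum>w\<leftarrow>?ws. \<bar>a \<bullet> w\<bar>) = (\<Sum>i<n. m i * \<bar>a \<bullet> xs ! i\<bar>)"
      by (simp add: o_def abs_mult m_def sum_list_distinct_conv_sum_set atLeast0LessThan)
    then have "\<bar>ball_moment a - (\<Sum>w\<leftarrow>?ws. \<bar>a \<bullet> w\<bar>)\<bar>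
        = \<bar>\<Sum>i<n. (LINT u:D i|lborel. \<bar>a \<bullet> u\<bar>) - m i * \<bar>a \<bullet> xs ! i\<bar>\<bar>"
      by (simp add: split sum_subtractf)
    also have "\<dots> \<le> (\<Sum>i<n. m i * (d * norm a))"
      using piece by (intro order_trans[OF sum_abs] sum_mono) auto
    also have "\<dots> = d * measure lborel (cball (0::'a) 1) * norm a"
      by (simp add: m_sum[symmetric] sum_distrib_right sum_distrib_left mult_ac)
    finally show "\<bar>ball_moment a - (\<Sum>w\<leftarrow>?ws. \<bar>a \<bullet> w\<bar>)\<bar> \<le> d * measure lborel (cball (0::'a) 1) * norm a" .
  qed
qed

lemma zonotope_between_cballs:
  fixes s t :: real
  assumes st: "0 \<le> s" "s < t"
  obtains ws :: "'a::euclidean_space list" where "cball 0 s \<subseteq> zonotope ws" "zonotope ws \<subseteq> cball 0 t"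
proof -
  obtain c where c: "c > 0" "\<And>a::'a. ball_moment a = c * norm a"
    using ball_moment_eq by blast
  define b where "b = measure lborel (cball (0::'a) 1)"
  have b: "b > 0"
    using unit_ball_vol_pos[of "real DIM('a)"] by (simp add: b_def content_cball)
  \<comment> \<open>This \<open>d\<close> makes \<open>c + d b\<close> and \<open>c - d b\<close>, the bounds for the Riemann sum on unit vectors, stand in the ratio \<open>t : s\<close>; the factor \<open>r\<close> then rescales them to \<open>t\<close> and \<open>s\<close>.\<close>
  define d where "d = c * (t - s) / ((t + s) * b)"
  have d: "d > 0" using st c b by (auto simp: d_def)
  obtain vs :: "'a list" where vs: "\<And>a. \<bar>ball_moment a - (\<Sum>w\<leftarrow>vs. \<bar>a \<bullet> w\<bar>)\<bar> \<le> d * b * norm a"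
    using ball_moment_approx[OF d] unfolding b_def by blast
  define r where "r = (t + s) / (2 * c)"
  have r: "r > 0" using st c by (simp add: r_def)
  have db: "r * (c + d * b) = t" "r * (c - d * b) = s"
  proof -
    have "d * b = c * (t - s) / (t + s)" using b by (simp add: d_def)
    moreover have "t + s > 0" using st by simp
    ultimately show "r * (c + d * b) = t" "r * (c - d * b) = s"
      using c(1) by (simp_all add: r_def divide_simps) (simp_all add: algebra_simps)
  qed
  define ws where "ws = map ((*\<^sub>R) r) vs"
  have sum_ws: "(\<Sum>w\<leftarrow>ws. \<bar>a \<bullet> w\<bar>) = r * (\<Sum>w\<leftarrow>vs. \<bar>a \<bullet> w\<bar>)" for a
    using r by (simp add: ws_def o_def abs_mult sum_list_const_mult)
  have "s * norm a \<le> (\<Sum>w\<leftarrow>ws. \<bar>a \<bullet> w\<bar>)" "(\<Sum>w\<leftarrow>ws. \<bar>a \<bullet> w\<bar>) \<le> t * norm a" for a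
  proof -
    have "(c - d * b) * norm a \<le> (\<Sum>w\<leftarrow>vs. \<bar>a \<bullet> w\<bar>)" "(\<Sum>w\<leftarrow>vs. \<bar>a \<bullet> w\<bar>) \<le> (c + d * b) * norm a"
      using vs[of a] c(2)[of a] by (auto simp: abs_le_iff algebra_simps)
    then have "r * ((c - d * b) * norm a) \<le> r * (\<Sum>w\<leftarrow>vs. \<bar>a \<bullet> w\<bar>)"
      "r * (\<Sum>w\<leftarrow>vs. \<bar>a \<bullet> w\<bar>) \<le> r * ((c + d * b) * norm a)"
      using r by (auto intro: mult_left_mono)
    then show "s * norm a \<le> (\<Sum>w\<leftarrow>ws. \<bar>a \<bullet> w\<bar>)" "(\<Sum>w\<leftarrow>ws. \<bar>a \<bullet> w\<bar>) \<le> t * norm a"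
      by (simp_all add: sum_ws mult.assoc[symmetric] db)
  qed
  then show thesis
    using st by (intro that[of ws] cball_subset_zonotope zonotope_subset_cball) auto
qed

section \<open>Volume increments of parallel bodies\<close>

text \<open>
  Stated as a property of the summand \<open>Z\<close> because it passes from two convex bodies to their
  Minkowski sum, and so from segments to zonotopes.
\<close>

definition monotone_increments :: "'a::euclidean_space set \<Rightarrow> 'a measure \<Rightarrow> 'a set \<Rightarrow> bool" where
  "monotone_increments E M Z \<longleftrightarrow> (\<forall>A A'. compact A \<longrightarrow> convex A \<longrightarrow> compact A' \<longrightarrow> A \<subseteq> A' \<longrightarrow> A' \<subseteq> E \<longrightarrow>
     measure M (A + Z) - measure M A \<le> measure M (A' + Z) - measure M A')"

context subspace_measure
begin

lemma measure_translation:
  assumes "v \<in> E" "compact A"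
  shows "measure M ((+) v ` A) = measure M A"
  using emeasure_translation[OF assms(1) compact_sets[OF assms(2)]] by (simp add: measure_def)

text \<open>
  Increments along a sum of segments telescope into increments along the single segments, each of
  which is monotone in the body that has been built so far.
\<close>

lemma monotone_increments_zonotope:
  assumes "set ws \<subseteq> E"
  shows "monotone_increments E M (zonotope ws)"
  using assms
proof (induction ws)
  case Nil
  then show ?case by (simp add: monotone_increments_def flip: set_zero)
next
  case (Cons w ws)
  then have w: "w \<in> E" and IH: "monotone_increments E M (zonotope ws)" by auto
  have w2: "2 *\<^sub>R w \<in> E" "- w \<in> E" using w subspace by (simp_all add: subspace_scale subspace_neg)
  let ?S = "closed_segment (- w) w"
  have S: "compact ?S" "convex ?S" "?S \<subseteq> E"
    using closed_segment_subset[OF w2(2) w subspace_imp_convex[OF subspace]] by simp_all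
  have shift: "measure M (A + ?S) = measure M (A + closed_segment 0 (2 *\<^sub>R w))" if "compact A" for A
  proof -
    have "?S = {- w} + closed_segment 0 (2 *\<^sub>R w)"
    proof -
      have "closed_segment (- w + 0) (- w + 2 *\<^sub>R w) = (+) (- w) ` closed_segment 0 (2 *\<^sub>R w)"
        by (rule closed_segment_translation)
      moreover have "- w + 2 *\<^sub>R w = w" by (simp add: scaleR_2)
      ultimately show ?thesis by (simp only: translation_eq_singleton_plus add_0_right)
    qed
    then have "A + ?S = (+) (- w) ` (A + closed_segment 0 (2 *\<^sub>R w))"
      by (simp only: translation_eq_singleton_plus) (simp only: ac_simps)
    then show ?thesis
      by (simp only: measure_translation[OF w2(2) compact_set_plus[OF that compact_segment]])
  qed
  show ?case
    unfolding monotone_increments_def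
  proof (intro allI impI)
    fix A A' assume A: "compact A" "convex A" "compact A'" "A \<subseteq> A'" "A' \<subseteq> E"
    have "measure M (A + ?S) - measure M A \<le> measure M (A' + ?S) - measure M A'"
      using segment_increment_mono[OF A w2(1)] A by (simp add: shift)
    moreover have "measure M (A + ?S + zonotope ws) - measure M (A + ?S)
        \<le> measure M (A' + ?S + zonotope ws) - measure M (A' + ?S)"
      using IH A S unfolding monotone_increments_def
      by (simp add: compact_set_plus convex_set_plus set_plus_subset set_plus_mono2)
    ultimately show "measure M (A + zonotope (w # ws)) - measure M A
        \<le> measure M (A' + zonotope (w # ws)) - measure M A'"
      by (simp add: add.assoc)
  qed
qed

end

text \<open>
  Projecting the ambient zonotopes to \<open>E\<close> gives zonotopes in \<open>E\<close> that approximate the unit ball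
  of \<open>E\<close>, because the projection maps the ball onto the ball of \<open>E\<close>.
\<close>

lemma nonexpansive_projection_exists:
  fixes E :: "'a::euclidean_space set"
  assumes "subspace E"
  obtains f where "linear f" "\<And>x. f x \<in> E" "\<And>x. x \<in> E \<Longrightarrow> f x = x" "\<And>x. norm (f x) \<le> norm x"
proof -
  obtain B where B: "B \<subseteq> E" "pairwise orthogonal B" "\<And>x. x \<in> B \<Longrightarrow> norm x = 1" "independent B" "span B = E"
    using orthonormal_basis_subspace[OF assms] by metis
  have fin: "finite B" using B(4) by (rule independent_imp_finite)
  define f where "f x = (\<Sum>b\<in>B. (x \<bullet> b) *\<^sub>R b)" for x
  have lin: "linear f"
    by (rule linearI) (simp_all add: f_def inner_add_left scaleR_add_left sum.distrib scaleR_sum_right)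
  have inE: "f x \<in> E" for x
    unfolding f_def using B(1) assms by (intro subspace_sum subspace_scale) auto
  have f_basis: "f b = b" if "b \<in> B" for b
  proof -
    have "(b \<bullet> c) *\<^sub>R c = (if c = b then b else 0)" if "c \<in> B" for c
      using B(2) B(3)[OF that] that \<open>b \<in> B\<close>
      by (auto simp: pairwise_def orthogonal_def dot_square_norm)
    then show ?thesis using that fin by (simp add: f_def)
  qed
  have f_id: "f x = x" if "x \<in> E" for x
    using that linear_eq_on_span[OF lin linear_id, of B] f_basis B(5) by simp
  have "norm (f x) \<le> norm x" for x
  proof -
    have orth: "(x - f x) \<bullet> y = 0" if "y \<in> E" for y
    proof -
      have "(x - f x) \<bullet> b = 0" if "b \<in> B" for b
      proof -
        have "f x \<bullet> b = (\<Sum>c\<in>B. if c = b then x \<bullet> b else 0)"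
          unfolding f_def inner_sum_left using B(2) B(3)[OF that] that
          by (intro sum.cong) (auto simp: pairwise_def orthogonal_def dot_square_norm)
        then show ?thesis using fin that by (simp add: inner_diff_left)
      qed
      then show ?thesis
        using orthogonal_to_span[of y B "x - f x"] that B(5) by (auto simp: orthogonal_def)
    qed
    have "f x \<bullet> f x = x \<bullet> f x"
      using orth[OF inE[of x]] by (simp add: inner_diff_left)
    then have "norm (f x) * norm (f x) \<le> norm x * norm (f x)"
      using norm_cauchy_schwarz[of x "f x"] by (simp add: dot_square_norm power2_eq_square)
    then show ?thesis by (cases "f x = 0") auto
  qed
  then show thesis using that lin inE f_id by blast
qed

lemma cball_inter_subspace_plus:
  fixes E :: "'a::euclidean_space set"
  assumes "subspace E" "s \<ge> 0" "t \<ge> 0"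
  shows "(cball 0 s \<inter> E) + (cball 0 t \<inter> E) = cball 0 (s + t) \<inter> E"
proof
  show "(cball 0 s \<inter> E) + (cball 0 t \<inter> E) \<subseteq> cball 0 (s + t) \<inter> E"
    using subspace_add[OF assms(1)] by (auto elim!: set_plus_elim intro: norm_triangle_mono)
  show "cball 0 (s + t) \<inter> E \<subseteq> (cball 0 s \<inter> E) + (cball 0 t \<inter> E)"
  proof
    fix x assume x: "x \<in> cball 0 (s + t) \<inter> E"
    show "x \<in> (cball 0 s \<inter> E) + (cball 0 t \<inter> E)"
    proof (cases "s + t = 0")
      case True
      with assms have "s = 0" "t = 0" by auto
      with x show ?thesis by (force intro: set_plus_intro[of 0 _ 0, simplified])
    next
      case False
      have "norm ((s / (s + t)) *\<^sub>R x) \<le> s" "norm ((t / (s + t)) *\<^sub>R x) \<le> t"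
      proof -
        have "norm x / (s + t) \<le> 1" using x False assms by simp
        from mult_left_mono[OF this assms(2)] mult_left_mono[OF this assms(3)] show "norm ((s / (s + t)) *\<^sub>R x) \<le> s" "norm ((t / (s + t)) *\<^sub>R x) \<le> t"
          using assms by simp_all
      qed
      moreover have "x = (s / (s + t)) *\<^sub>R x + (t / (s + t)) *\<^sub>R x"
        using False by (simp add: scaleR_add_left[symmetric] add_divide_distrib[symmetric])
      ultimately show ?thesis
        using x subspace_scale[OF assms(1)] by (metis IntD2 IntI mem_cball_0 set_plus_intro)
    qed
  qed
qed

definition parallel_body :: "'a::euclidean_space set \<Rightarrow> real \<Rightarrow> 'a set \<Rightarrow> 'a set" where
  "parallel_body E t A = A + (cball 0 t \<inter> E)"

context subspace_measure
begin

lemma compact_parallel_body: "compact A \<Longrightarrow> compact (parallel_body E t A)"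
  unfolding parallel_body_def
  by (intro compact_set_plus compact_Int_closed closed_subspace subspace) auto

lemma parallel_body_subset: "A \<subseteq> E \<Longrightarrow> parallel_body E t A \<subseteq> E"
  unfolding parallel_body_def by (intro set_plus_subset) auto

lemma subset_parallel_body: "t \<ge> 0 \<Longrightarrow> A \<subseteq> parallel_body E t A"
  unfolding parallel_body_def
  using set_zero_plus2[of "cball 0 t \<inter> E" A] subspace_0[OF subspace] by (simp add: add.commute)

lemma parallel_body_parallel_body:
  "s \<ge> 0 \<Longrightarrow> t \<ge> 0 \<Longrightarrow> parallel_body E t (parallel_body E s A) = parallel_body E (s + t) A"
  unfolding parallel_body_def by (simp add: add.assoc cball_inter_subspace_plus[OF subspace])

lemma parallel_body_eq_infdist:
  assumes "compact A" "A \<noteq> {}" "A \<subseteq> E" "t \<ge> 0"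
  shows "parallel_body E t A = {x \<in> E. infdist x A \<le> t}"
proof (intro equalityI subsetI)
  fix x assume x: "x \<in> parallel_body E t A"
  then obtain a b where ab: "a \<in> A" "norm b \<le> t" "x = a + b"
    by (auto simp: parallel_body_def elim!: set_plus_elim)
  have "infdist x A \<le> dist x a" using ab(1) by (rule infdist_le)
  also have "\<dots> \<le> t" using ab by (simp add: dist_norm)
  finally show "x \<in> {x \<in> E. infdist x A \<le> t}"
    using x parallel_body_subset[OF assms(3)] by auto
next
  fix x assume x: "x \<in> {x \<in> E. infdist x A \<le> t}"
  obtain a where a: "a \<in> A" "infdist x A = dist x a"
    using infdist_attains_inf[OF compact_imp_closed[OF assms(1)] assms(2)] by blast
  have "x - a \<in> cball 0 t \<inter> E"
    using x a assms(3) subspace_diff[OF subspace] by (auto simp: dist_norm norm_minus_commute)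
  with a(1) have "a + (x - a) \<in> parallel_body E t A"
    unfolding parallel_body_def by (rule set_plus_intro)
  then show "x \<in> parallel_body E t A" by simp
qed

text \<open>
  The parallel bodies are sublevel sets of the distance to \<open>A\<close>, hence decrease to
  \<^term>\<open>parallel_body E t A\<close> as the radius decreases to \<open>t\<close>.
\<close>

lemma measure_parallel_body_right_continuous:
  assumes A: "compact A" "A \<subseteq> E" and t: "t \<ge> 0"
  shows "(\<lambda>n. measure M (parallel_body E (t + 1 / real (Suc n)) A)) \<longlonglongrightarrow> measure M (parallel_body E t A)"
proof (cases "A = {}")
  case True
  then have "parallel_body E s A = {}" for s by (simp add: parallel_body_def set_plus_def)
  then show ?thesis by simp
next
  case False
  let ?P = "\<lambda>n. parallel_body E (t + 1 / real (Suc n)) A"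
  have P: "?P n = {x \<in> E. infdist x A \<le> t + 1 / real (Suc n)}" for n
    using t by (intro parallel_body_eq_infdist A False) simp
  have "(\<lambda>n. measure M (?P n)) \<longlonglongrightarrow> measure M (\<Inter>n. ?P n)"
  proof (rule Lim_measure_decseq)
    show "range ?P \<subseteq> sets M"
      using compact_sets compact_parallel_body[OF A(1)] by blast
    show "decseq ?P"
    proof (rule decseq_SucI)
      fix n
      have "1 / real (Suc (Suc n)) \<le> 1 / real (Suc n)" by (simp add: divide_simps)
      then show "?P (Suc n) \<subseteq> ?P n" unfolding P by auto
    qed
    show "emeasure M (?P n) \<noteq> \<infinity>" for n
      using compact_finite[OF compact_parallel_body[OF A(1)] parallel_body_subset[OF A(2)]]
      by (metis less_irrefl)
  qed
  also have "(\<Inter>n. ?P n) = parallel_body E t A"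
    unfolding P parallel_body_eq_infdist[OF A(1) False A(2) t]
  proof (intro equalityI subsetI)
    fix x assume x: "x \<in> (\<Inter>n. {x \<in> E. infdist x A \<le> t + 1 / real (Suc n)})"
    have "infdist x A \<le> t"
    proof (rule field_le_epsilon)
      fix e :: real assume "e > 0"
      then obtain n where "1 / real (Suc n) < e" using nat_approx_posE by blast
      moreover have "infdist x A \<le> t + 1 / real (Suc n)" using x by blast
      ultimately show "infdist x A \<le> t + e" by simp
    qed
    with x show "x \<in> {x \<in> E. infdist x A \<le> t}" by auto
  next
    fix x assume "x \<in> {x \<in> E. infdist x A \<le> t}"
    moreover have "1 / real (Suc n) \<ge> 0" for n by simp
    ultimately show "x \<in> (\<Inter>n. {x \<in> E. infdist x A \<le> t + 1 / real (Suc n)})"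
      by (auto intro: order_trans)
  qed
  finally show ?thesis .
qed

lemma measure_mono_compact:
  "compact A \<Longrightarrow> compact A' \<Longrightarrow> A \<subseteq> A' \<Longrightarrow> A' \<subseteq> E \<Longrightarrow> measure M A \<le> measure M A'"
  by (intro measure_mono_fmeasurable compact_sets compact_fmeasurable)

text \<open>
  Monotonicity of the volume increment under a Euclidean ball, the key inequality.  It holds for
  every zonotope that lies between the balls of radius \<open>t\<close> and \<open>s\<close> for some \<open>s > t\<close>; letting \<open>s\<close>
  tend to \<open>t\<close> is possible by right continuity.
\<close>

lemma parallel_body_increment_mono:
  assumes A: "compact A" "convex A" and A': "compact A'" "A \<subseteq> A'" "A' \<subseteq> E" and t: "t \<ge> 0"
  shows "measure M (parallel_body E t A) - measure M A \<le> measure M (parallel_body E t A') - measure M A'"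
proof -
  have AE: "A \<subseteq> E" using A' by blast
  obtain f where f: "linear f" "\<And>x. f x \<in> E" "\<And>x. x \<in> E \<Longrightarrow> f x = x" "\<And>x. norm (f x) \<le> norm x"
    using nonexpansive_projection_exists[OF subspace] by metis
  have step: "measure M (parallel_body E t A) - measure M A \<le> measure M (parallel_body E s A') - measure M A'"
    if ts: "t < s" for s
  proof -
    obtain vs :: "'a list" where vs: "cball 0 t \<subseteq> zonotope vs" "zonotope vs \<subseteq> cball 0 s"
      using zonotope_between_cballs[OF t ts] by blast
    define Z where "Z = zonotope (map f vs)"
    have Z_eq: "Z = f ` zonotope vs" by (simp add: Z_def zonotope_linear_image[OF f(1)])
    have Z: "compact Z" "Z \<subseteq> E" "monotone_increments E M Z"
    proof -
      have "set (map f vs) \<subseteq> E" using f(2) by auto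
      then show "Z \<subseteq> E" "monotone_increments E M Z"
        unfolding Z_def by (rule zonotope_subset[OF subspace], rule monotone_increments_zonotope)
      show "compact Z" unfolding Z_def by (rule compact_zonotope)
    qed
    have tZ: "cball 0 t \<inter> E \<subseteq> Z"
      unfolding Z_eq using vs(1) f(3) by (metis IntE image_eqI subset_iff)
    have Zs: "Z \<subseteq> cball 0 s \<inter> E"
    proof
      fix z assume "z \<in> Z"
      then obtain y where "y \<in> zonotope vs" "z = f y" unfolding Z_eq by blast
      then show "z \<in> cball 0 s \<inter> E" using vs(2) f(2) order_trans[OF f(4)[of y]] by auto
    qed
    have "measure M (parallel_body E t A) - measure M A \<le> measure M (A + Z) - measure M A"
      unfolding parallel_body_def
      using tZ Z A AE closed_subspace[OF subspace]
      by (intro diff_mono order_refl measure_mono_compact compact_set_plus set_plus_mono2 set_plus_subset compact_Int_closed) auto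
    also have "\<dots> \<le> measure M (A' + Z) - measure M A'"
      using Z(3) A A' unfolding monotone_increments_def by blast
    also have "\<dots> \<le> measure M (parallel_body E s A') - measure M A'"
      unfolding parallel_body_def
      using Zs Z A' closed_subspace[OF subspace]
      by (intro diff_mono order_refl measure_mono_compact compact_set_plus set_plus_mono2 set_plus_subset compact_Int_closed) auto
    finally show ?thesis .
  qed
  show ?thesis
  proof (rule LIMSEQ_le_const)
    show "(\<lambda>n. measure M (parallel_body E (t + 1 / real (Suc n)) A') - measure M A')
        \<longlonglongrightarrow> measure M (parallel_body E t A') - measure M A'"
      by (intro tendsto_diff measure_parallel_body_right_continuous A' t tendsto_const)
    show "\<exists>N. \<forall>n\<ge>N. measure M (parallel_body E t A) - measure M A
        \<le> measure M (parallel_body E (t + 1 / real (Suc n)) A') - measure M A'"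
      using step by simp
  qed
qed

end

text \<open>
  This is the limit theorem of Fekete at \<open>0\<close>: if \<open>t\<close> is small then \<open>k = \<lfloor>T / t\<rfloor>\<close> gives
  \<open>k f(t) \<le> f(T)\<close> while \<open>k t > T - t\<close>, so the quotient at \<open>t\<close> is at most \<open>f(T) / (T - t)\<close>.
\<close>

lemma superadditive_quotient_tendsto:
  fixes f :: "real \<Rightarrow> real"
  assumes nonneg: "\<And>t. t \<ge> 0 \<Longrightarrow> f t \<ge> 0"
    and super: "\<And>s t. s \<ge> 0 \<Longrightarrow> t \<ge> 0 \<Longrightarrow> f s + f t \<le> f (s + t)"
  shows "((\<lambda>t. f t / t) \<longlongrightarrow> (INF t\<in>{0<..}. f t / t)) (at_right 0)"
proof -
  let ?L = "INF t\<in>{0<..}. f t / t"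
  have bdd: "bdd_below ((\<lambda>t. f t / t) ` {0<..})"
    by (rule bdd_belowI2[of _ 0]) (simp add: nonneg)
  have lower: "?L \<le> f t / t" if "t > 0" for t
    using that by (intro cINF_lower bdd) auto
  have mult: "real k * f t \<le> f (real k * t)" if "t \<ge> 0" for k t
  proof (induction k)
    case (Suc k)
    then show ?case using super[of t "real k * t"] that by (simp add: algebra_simps)
  qed (use nonneg in simp)
  have upper: "f t / t \<le> f T / (T - t)" if t: "0 < t" "t < T" for t T
  proof -
    define k where "k = nat \<lfloor>T / t\<rfloor>"
    have "T / t > 0" using t by simp
    then have k: "real k \<le> T / t" "T / t < real k + 1" unfolding k_def by linarith+
    then have kt: "real k * t \<le> T" "T - t < real k * t" using t by (simp_all add: field_simps)
    have "(T - t) * f t \<le> (real k * t) * f t"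
      using kt nonneg[of t] t by (intro mult_right_mono) auto
    also have "\<dots> = t * (real k * f t)" by simp
    also have "\<dots> \<le> t * f T"
      using mult[of t k] super[of "real k * t" "T - real k * t"] nonneg[of "T - real k * t"] kt t
      by (intro mult_left_mono) auto
    finally show ?thesis using t by (simp add: field_simps)
  qed
  show ?thesis
  proof (rule order_tendstoI)
    fix a assume "a < ?L"
    then show "\<forall>\<^sub>F t in at_right 0. a < f t / t"
      using lower by (intro eventually_at_rightI[of 0 1]) (force intro: less_le_trans)+
  next
    fix a assume "?L < a"
    then obtain T where T: "T > 0" "f T / T < a"
      using cINF_less_iff[OF _ bdd] by auto
    have "((\<lambda>t. f T / (T - t)) \<longlongrightarrow> f T / (T - 0)) (at_right 0)"
      using T by (intro tendsto_intros) auto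
    then have "\<forall>\<^sub>F t in at_right 0. f T / (T - t) < a"
      using T by (intro order_tendstoD(2)) auto
    moreover have "\<forall>\<^sub>F t in at_right 0. 0 < t \<and> t < T"
      using T by (intro eventually_at_rightI[of 0 T]) auto
    ultimately show "\<forall>\<^sub>F t in at_right 0. f t / t < a"
    proof eventually_elim
      case (elim t)
      then show ?case using upper[of t T] by linarith
    qed
  qed
qed

context subspace_measure
begin

text \<open>
  The increment is superadditive in the radius: the step from \<open>s\<close> to \<open>s + t\<close> is an increment of
  radius \<open>t\<close> for the larger body \<^term>\<open>parallel_body E s A\<close>.
\<close>

lemma parallel_body_quotient_convergent:
  assumes A: "compact A" "convex A" "A \<subseteq> E"
  shows "\<exists>l. ((\<lambda>t. (measure M (parallel_body E t A) - measure M A) / t) \<longlongrightarrow> l) (at_right 0)"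
proof (intro exI, rule superadditive_quotient_tendsto[of "\<lambda>t. measure M (parallel_body E t A) - measure M A"])
  fix t :: real assume "t \<ge> 0"
  then show "0 \<le> measure M (parallel_body E t A) - measure M A"
    using measure_mono_compact[OF A(1) compact_parallel_body[OF A(1)] subset_parallel_body parallel_body_subset[OF A(3)]]
    by simp
next
  fix s t :: real assume st: "s \<ge> 0" "t \<ge> 0"
  have "measure M (parallel_body E t A) - measure M A
    \<le> measure M (parallel_body E t (parallel_body E s A)) - measure M (parallel_body E s A)"
    using A st
    by (intro parallel_body_increment_mono compact_parallel_body subset_parallel_body parallel_body_subset)
  then show "measure M (parallel_body E s A) - measure M A + (measure M (parallel_body E t A) - measure M A)
    \<le> measure M (parallel_body E (s + t) A) - measure M A"
    using st by (simp add: parallel_body_parallel_body)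
qed

end

section \<open>Surface area in a subspace\<close>

lemma lborel_subspace_basis:
  fixes E :: "'a::euclidean_space set"
  assumes "subspace E"
  obtains B where "B \<subseteq> E" "finite B" "pairwise orthogonal B" "\<forall>b\<in>B. norm b = 1" "span B = E" "card B = dim E"
    "lborel_subspace E = distr (\<Pi>\<^sub>M b\<in>B. lborel) borel (\<lambda>f. \<Sum>b\<in>B. f b *\<^sub>R b)"
proof -
  define B where "B = (SOME B. orthonormal_basis_of E B)"
  have "\<exists>B. orthonormal_basis_of E B"
    using orthonormal_basis_subspace[OF assms] unfolding orthonormal_basis_of_def by metis
  then have B: "orthonormal_basis_of E B"
    unfolding B_def by (rule someI_ex)
  then have "pairwise orthogonal B" "\<forall>b\<in>B. norm b = 1" "span B = E"
    by (auto simp: orthonormal_basis_of_def)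
  moreover from this have "independent B"
    by (intro pairwise_orthogonal_independent) (auto dest: bspec[of _ _ 0])
  moreover have "lborel_subspace E = distr (\<Pi>\<^sub>M b\<in>B. lborel) borel (\<lambda>f. \<Sum>b\<in>B. f b *\<^sub>R b)"
    by (simp add: lborel_subspace_def B_def Let_def)
  ultimately show thesis
    using that[of B] independent_imp_finite[of B] dim_span_eq_card_independent[of B] span_superset[of B] by simp
qed

lemma inner_orthonormal_sum:
  fixes B :: "'a::euclidean_space set"
  assumes "finite B" "pairwise orthogonal B" "\<forall>b\<in>B. norm b = 1" "c \<in> B"
  shows "(\<Sum>b\<in>B. f b *\<^sub>R b) \<bullet> c = f c"
proof -
  have "(\<Sum>b\<in>B. f b *\<^sub>R b) \<bullet> c = (\<Sum>b\<in>B. if b = c then f c else 0)"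
    unfolding inner_sum_left using assms(2-4)
    by (intro sum.cong) (auto simp: pairwise_def orthogonal_def dot_square_norm)
  then show ?thesis using assms by simp
qed

lemma norm_orthonormal_sum:
  fixes B :: "'a::euclidean_space set"
  assumes "finite B" "pairwise orthogonal B" "\<forall>b\<in>B. norm b = 1"
  shows "norm (\<Sum>b\<in>B. f b *\<^sub>R b) = sqrt (\<Sum>b\<in>B. (f b)\<^sup>2)"
proof -
  have "(norm (\<Sum>b\<in>B. f b *\<^sub>R b))\<^sup>2 = (\<Sum>b\<in>B. (norm (f b *\<^sub>R b))\<^sup>2)"
    using assms by (intro norm_sum_Pythagorean pairwise_ortho_scaleR)
  also have "\<dots> = (\<Sum>b\<in>B. (f b)\<^sup>2)"
    using assms(3) by simp
  finally show ?thesis by (metis norm_ge_zero real_sqrt_unique)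
qed

lemma orthonormal_sum_measurable:
  "(\<lambda>f. \<Sum>b\<in>B. f b *\<^sub>R b) \<in> borel_measurable (\<Pi>\<^sub>M b\<in>B. lborel :: real measure)"
  for B :: "'a::euclidean_space set"
proof -
  have "(\<lambda>f. f b) \<in> borel_measurable (\<Pi>\<^sub>M b\<in>B. lborel :: real measure)" if "b \<in> B" for b
    using measurable_component_singleton[OF that, of "\<lambda>_. lborel :: real measure"] by simp
  then show ?thesis
    by (intro borel_measurable_sum borel_measurable_scaleR borel_measurable_const)
qed

text \<open>
  In the coordinates of an orthonormal basis the ball of \<open>E\<close> becomes the standard ball in a
  product of lines.  The value depends on \<open>dim E\<close> only, so all hyperplanes give the same result.
\<close>

lemma emeasure_lborel_subspace_cball:
  fixes E :: "'a::euclidean_space set"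
  assumes E: "subspace E" and r: "r > 0"
  shows "emeasure (lborel_subspace E) (cball 0 r \<inter> E) = ennreal (unit_ball_vol (real (dim E)) * r ^ dim E)"
proof -
  obtain B where B: "B \<subseteq> E" "finite B" "pairwise orthogonal B" "\<forall>b\<in>B. norm b = 1" "span B = E" "card B = dim E"
    and M: "lborel_subspace E = distr (\<Pi>\<^sub>M b\<in>B. lborel) borel (\<lambda>f. \<Sum>b\<in>B. f b *\<^sub>R b)"
    using lborel_subspace_basis[OF E] .
  have inE: "(\<Sum>b\<in>B. f b *\<^sub>R b) \<in> E" for f
    using B(1) E by (intro subspace_sum subspace_scale) auto
  have "emeasure (lborel_subspace E) (cball 0 r \<inter> E)
      = emeasure (\<Pi>\<^sub>M b\<in>B. lborel) ({f. sqrt (\<Sum>b\<in>B. (f b)\<^sup>2) \<le> r} \<inter> space (\<Pi>\<^sub>M b\<in>B. lborel))"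
    unfolding M
  proof (subst emeasure_distr[OF orthonormal_sum_measurable])
    show "cball 0 r \<inter> E \<in> sets borel"
      by (intro borel_closed closed_Int closed_cball closed_subspace E)
    have "(\<lambda>f. \<Sum>b\<in>B. f b *\<^sub>R b) -` (cball 0 r \<inter> E) = {f. sqrt (\<Sum>b\<in>B. (f b)\<^sup>2) \<le> r}"
      using inE by (auto simp: norm_orthonormal_sum[OF B(2-4)])
    then show "emeasure (\<Pi>\<^sub>M b\<in>B. lborel) ((\<lambda>f. \<Sum>b\<in>B. f b *\<^sub>R b) -` (cball 0 r \<inter> E) \<inter> space (\<Pi>\<^sub>M b\<in>B. lborel))
      = emeasure (\<Pi>\<^sub>M b\<in>B. lborel) ({f. sqrt (\<Sum>b\<in>B. (f b)\<^sup>2) \<le> r} \<inter> space (\<Pi>\<^sub>M b\<in>B. lborel))"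
      by simp
  qed
  also have "\<dots> = ennreal (unit_ball_vol (real (dim E)) * r ^ dim E)"
    using emeasure_cball_aux[OF B(2) r] B(6) by simp
  finally show ?thesis .
qed

interpretation lborel_product: product_sigma_finite "\<lambda>_. lborel :: real measure" ..

lemma PiM_lborel_translation:
  assumes "finite B"
  shows "distr (\<Pi>\<^sub>M b\<in>B. lborel) (\<Pi>\<^sub>M b\<in>B. lborel) (\<lambda>f. \<lambda>b\<in>B. v b + f b) = (\<Pi>\<^sub>M b\<in>B. lborel :: real measure)"
proof (rule lborel_product.PiM_eqI[OF assms])
  let ?P = "\<Pi>\<^sub>M b\<in>B. lborel :: real measure"
  let ?T = "\<lambda>f. \<lambda>b\<in>B. v b + f b"
  have T: "?T \<in> measurable ?P ?P"
    by (intro measurable_restrict) measurable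
  fix A :: "_ \<Rightarrow> real set" assume A: "\<And>b. b \<in> B \<Longrightarrow> A b \<in> sets lborel"
  have A': "(+) (v b) -` A b \<in> sets borel" if "b \<in> B" for b
    using measurable_sets[of "(+) (v b)" borel borel "A b"] A[OF that] by simp
  have shift: "emeasure lborel ((+) (v b) -` A b) = emeasure lborel (A b)" if "b \<in> B" for b
  proof -
    have "emeasure lborel (A b) = emeasure (distr lborel borel ((+) (v b))) (A b)"
      using lborel_affine[of 1 "v b"] by (simp add: density_1)
    then show ?thesis
      using A[OF that] by (simp add: emeasure_distr)
  qed
  have "emeasure (distr ?P ?P ?T) (Pi\<^sub>E B A) = emeasure ?P (?T -` Pi\<^sub>E B A \<inter> space ?P)"
    using A assms by (intro emeasure_distr T sets_PiM_I_finite) auto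
  also have "?T -` Pi\<^sub>E B A \<inter> space ?P = Pi\<^sub>E B (\<lambda>b. (+) (v b) -` A b)"
    by (auto simp: space_PiM PiE_def Pi_def extensional_def)
  also have "emeasure ?P \<dots> = (\<Prod>b\<in>B. emeasure lborel ((+) (v b) -` A b))"
    using assms A' by (intro lborel_product.emeasure_PiM) auto
  also have "\<dots> = (\<Prod>b\<in>B. emeasure lborel (A b))"
    using shift by (intro prod.cong) auto
  finally show "emeasure (distr ?P ?P ?T) (Pi\<^sub>E B A) = (\<Prod>b\<in>B. emeasure lborel (A b))" .
qed simp

lemma lborel_subspace_translation:
  fixes E :: "'a::euclidean_space set"
  assumes E: "subspace E" and v: "v \<in> E"
  shows "distr (lborel_subspace E) borel ((+) v) = lborel_subspace E"
proof -
  obtain B where B: "B \<subseteq> E" "finite B" "pairwise orthogonal B" "\<forall>b\<in>B. norm b = 1" "span B = E" "card B = dim E"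
    and M: "lborel_subspace E = distr (\<Pi>\<^sub>M b\<in>B. lborel) borel (\<lambda>f. \<Sum>b\<in>B. f b *\<^sub>R b)"
    using lborel_subspace_basis[OF E] .
  let ?P = "\<Pi>\<^sub>M b\<in>B. lborel :: real measure"
  let ?\<phi> = "\<lambda>f. \<Sum>b\<in>B. f b *\<^sub>R b"
  obtain u where u: "v = (\<Sum>b\<in>B. u b *\<^sub>R b)"
    using v B(2,5) by (auto simp: span_finite)
  let ?T = "\<lambda>f. \<lambda>b\<in>B. u b + f b"
  have T: "?T \<in> measurable ?P ?P"
    by (intro measurable_restrict) measurable
  have "distr (lborel_subspace E) borel ((+) v) = distr ?P borel ((+) v \<circ> ?\<phi>)"
    unfolding M by (intro distr_distr orthonormal_sum_measurable) simp
  also have "(+) v \<circ> ?\<phi> = ?\<phi> \<circ> ?T"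
    by (auto simp: u sum.distrib[symmetric] scaleR_add_left intro!: sum.cong)
  also have "distr ?P borel (?\<phi> \<circ> ?T) = distr (distr ?P ?P ?T) borel ?\<phi>"
    by (intro distr_distr[symmetric] orthonormal_sum_measurable T)
  also have "\<dots> = lborel_subspace E"
    unfolding M PiM_lborel_translation[OF B(2)] ..
  finally show ?thesis .
qed

lemma subspace_measure_lborel_subspace:
  fixes E :: "'a::euclidean_space set"
  assumes E: "subspace E"
  shows "subspace_measure E (lborel_subspace E)"
proof
  show sets: "sets (lborel_subspace E) = sets borel"
    by (simp add: lborel_subspace_def Let_def)
  fix A assume A: "compact A" "A \<subseteq> E"
  obtain r where "r > 0" "\<forall>x\<in>A. norm x \<le> r"
    using compact_imp_bounded[OF A(1)] unfolding bounded_pos by blast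
  then have r: "r > 0" "A \<subseteq> cball 0 r" by auto
  have "cball 0 r \<inter> E \<in> sets (lborel_subspace E)"
    unfolding sets by (intro borel_closed closed_Int closed_cball closed_subspace E)
  then have "emeasure (lborel_subspace E) A \<le> emeasure (lborel_subspace E) (cball 0 r \<inter> E)"
    using A(2) r(2) by (intro emeasure_mono) auto
  then show "emeasure (lborel_subspace E) A < \<infinity>"
    using emeasure_lborel_subspace_cball[OF E r(1)] by (auto simp: less_top intro: le_less_trans)
qed (use E lborel_subspace_translation in auto)

text \<open>
  The surface area is a genuine limit for convex compact sets, including those without interior
  points in \<open>E\<close>, such as the flat cube that bounds the surface area of thin slabs from below.
\<close>

lemma surface_area_tendsto:
  fixes A :: "'a::euclidean_space set"
  assumes E: "subspace E" and A: "compact A" "convex A" "A \<subseteq> E"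
  shows "((\<lambda>t. (measure (lborel_subspace E) (parallel_body E t A) - measure (lborel_subspace E) A) / t)
    \<longlongrightarrow> surface_area E A) (at_right 0)"
proof -
  interpret subspace_measure E "lborel_subspace E"
    by (rule subspace_measure_lborel_subspace[OF E])
  let ?q = "\<lambda>t. (measure (lborel_subspace E) (parallel_body E t A) - measure (lborel_subspace E) A) / t"
  obtain l where l: "(?q \<longlongrightarrow> l) (at_right 0)"
    using parallel_body_quotient_convergent[OF A] by blast
  have eq: "{a + t *\<^sub>R b | a b. a \<in> A \<and> b \<in> cball 0 1 \<inter> E} = parallel_body E t A" if t: "t > 0" for t
  proof -
    have "cball 0 t \<inter> E = (*\<^sub>R) t ` (cball 0 1 \<inter> E)"
    proof (intro equalityI subsetI)
      fix x assume "x \<in> cball 0 t \<inter> E"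
      then have "(1 / t) *\<^sub>R x \<in> cball 0 1 \<inter> E"
        using t by (auto intro: subspace_scale[OF E])
      then have "t *\<^sub>R (1 / t) *\<^sub>R x \<in> (*\<^sub>R) t ` (cball 0 1 \<inter> E)" by blast
      then show "x \<in> (*\<^sub>R) t ` (cball 0 1 \<inter> E)" using t by simp
    qed (use t in \<open>auto intro: subspace_scale[OF E] simp: mult_left_le\<close>)
    then have "parallel_body E t A = A + (*\<^sub>R) t ` (cball 0 1 \<inter> E)"
      by (simp only: parallel_body_def)
    then show ?thesis unfolding set_plus_def by blast
  qed
  have "((\<lambda>t. (measure (lborel_subspace E) {a + t *\<^sub>R b | a b. a \<in> A \<and> b \<in> cball 0 1 \<inter> E}
      - measure (lborel_subspace E) A) / t) \<longlongrightarrow> l) (at_right 0)"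
  proof (rule Lim_transform_eventually[OF l])
    show "\<forall>\<^sub>F t in at_right 0. ?q t = (measure (lborel_subspace E) {a + t *\<^sub>R b | a b. a \<in> A \<and> b \<in> cball 0 1 \<inter> E}
      - measure (lborel_subspace E) A) / t"
      using eventually_at_right_less by eventually_elim (simp only: eq)
  qed
  then have "surface_area E A = l"
    unfolding surface_area_def by (intro tendsto_Lim) simp_all
  with l show ?thesis by simp
qed

lemma surface_area_mono:
  fixes A A' :: "'a::euclidean_space set"
  assumes E: "subspace E" and A: "compact A" "convex A" and A': "compact A'" "convex A'" "A \<subseteq> A'" "A' \<subseteq> E"
  shows "surface_area E A \<le> surface_area E A'"
proof -
  interpret subspace_measure E "lborel_subspace E"
    by (rule subspace_measure_lborel_subspace[OF E])
  have AE: "A \<subseteq> E" using A' by blast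
  show ?thesis
  proof (rule tendsto_le[OF _ surface_area_tendsto[OF E A'(1,2,4)] surface_area_tendsto[OF E A AE]])
    show "\<forall>\<^sub>F t in at_right 0. (measure (lborel_subspace E) (parallel_body E t A) - measure (lborel_subspace E) A) / t
        \<le> (measure (lborel_subspace E) (parallel_body E t A') - measure (lborel_subspace E) A') / t"
      using eventually_at_right_less
      by eventually_elim (intro divide_right_mono parallel_body_increment_mono A A', simp_all)
  qed simp
qed

lemma surface_area_unit_cball:
  fixes E :: "'a::euclidean_space set"
  assumes E: "subspace E"
  shows "surface_area E (cball 0 1 \<inter> E) = real (dim E) * unit_ball_vol (real (dim E))"
proof -
  let ?M = "lborel_subspace E" and ?B = "cball 0 1 \<inter> E"
  define m where "m = dim E"
  define \<kappa> where "\<kappa> = unit_ball_vol (real m)"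
  have \<kappa>: "\<kappa> \<ge> 0" by (simp add: \<kappa>_def)
  have vol: "measure ?M (cball 0 r \<inter> E) = \<kappa> * r ^ m" if "r > 0" for r
    using emeasure_lborel_subspace_cball[OF E that] \<kappa> that by (simp add: measure_def m_def \<kappa>_def)
  have "((\<lambda>t. \<kappa> * (1 + t) ^ m) has_field_derivative \<kappa> * (real m * (1 + 0) ^ (m - 1))) (at 0)"
    by (auto intro!: derivative_eq_intros)
  then have "((\<lambda>t. (\<kappa> * (1 + t) ^ m - \<kappa>) / t) \<longlongrightarrow> real m * \<kappa>) (at 0)"
    by (simp add: has_field_derivative_iff mult.commute)
  then have lim: "((\<lambda>t. (\<kappa> * (1 + t) ^ m - \<kappa>) / t) \<longlongrightarrow> real m * \<kappa>) (at_right 0)"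
    by (rule filterlim_mono) (auto simp: at_le)
  have "((\<lambda>t. (measure ?M (parallel_body E t ?B) - measure ?M ?B) / t) \<longlongrightarrow> real m * \<kappa>) (at_right 0)"
  proof (rule Lim_transform_eventually[OF lim])
    have "(\<kappa> * (1 + t) ^ m - \<kappa>) / t = (measure ?M (parallel_body E t ?B) - measure ?M ?B) / t" if "0 < t" for t
      using that vol[of "1 + t"] vol[of 1] by (simp add: parallel_body_def cball_inter_subspace_plus[OF E])
    then show "\<forall>\<^sub>F t in at_right 0. (\<kappa> * (1 + t) ^ m - \<kappa>) / t = (measure ?M (parallel_body E t ?B) - measure ?M ?B) / t"
      using eventually_at_right_less[of "0::real"] by (auto elim: eventually_mono)
  qed
  moreover have "((\<lambda>t. (measure ?M (parallel_body E t ?B) - measure ?M ?B) / t) \<longlongrightarrow> surface_area E ?B) (at_right 0)"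
    by (intro surface_area_tendsto E convex_Int convex_cball subspace_imp_convex compact_Int_closed closed_subspace) auto
  ultimately show ?thesis
    unfolding m_def[symmetric] \<kappa>_def[symmetric] by (intro tendsto_unique[of "at_right 0"]) auto
qed

section \<open>The slab of the unit ball\<close>

definition slab :: "'a::euclidean_space \<Rightarrow> real \<Rightarrow> 'a set" where
  "slab e h = {x \<in> cball 0 1. \<bar>x \<bullet> e\<bar> \<le> h}"

lemma compact_slab: "compact (slab e h)"
proof -
  have "slab e h = cball 0 1 \<inter> {x. \<bar>x \<bullet> e\<bar> \<le> h}" by (auto simp: slab_def)
  moreover have "closed {x. \<bar>x \<bullet> e\<bar> \<le> h}"
    by (intro closed_Collect_le continuous_intros)
  ultimately show ?thesis by (simp add: compact_Int_closed)
qed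

lemma convex_slab: "convex (slab e h)"
proof -
  have "slab e h = cball 0 1 \<inter> {x. e \<bullet> x \<le> h} \<inter> {x. e \<bullet> x \<ge> - h}"
    by (auto simp: slab_def inner_commute abs_le_iff)
  then show ?thesis
    by (simp add: convex_Int convex_halfspace_le convex_halfspace_ge)
qed

lemma convex_body_slab:
  fixes e :: "'a::euclidean_space"
  assumes "norm e = 1" "h > 0"
  shows "convex_body (slab e h)"
proof -
  have "ball 0 (min 1 h) \<subseteq> slab e h"
  proof
    fix x :: 'a assume "x \<in> ball 0 (min 1 h)"
    then show "x \<in> slab e h"
      using Cauchy_Schwarz_ineq2[of x e] assms(1) by (simp add: slab_def)
  qed
  then have "ball 0 (min 1 h) \<subseteq> interior (slab e h)"
    by (intro interior_maximal) auto
  moreover have "0 \<in> ball (0::'a) (min 1 h)" using assms(2) by simp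
  ultimately show ?thesis
    unfolding convex_body_def using compact_slab convex_slab by blast
qed

lemma measure_slab_tendsto_0:
  assumes "norm e = 1"
  shows "(\<lambda>k. measure lborel (slab e (1 / real (Suc k)))) \<longlonglongrightarrow> 0"
proof -
  let ?K = "\<lambda>k. slab e (1 / real (Suc k))"
  have "(\<lambda>k. measure lborel (?K k)) \<longlonglongrightarrow> measure lborel (\<Inter>k. ?K k)"
  proof (rule Lim_measure_decseq)
    show "range ?K \<subseteq> sets lborel"
      using borel_compact[OF compact_slab] by auto
    show "decseq ?K"
    proof (rule decseq_SucI)
      fix n
      have "1 / real (Suc (Suc n)) \<le> 1 / real (Suc n)" by (simp add: divide_simps)
      then show "?K (Suc n) \<subseteq> ?K n" unfolding slab_def by fastforce
    qed
    show "emeasure lborel (?K k) \<noteq> \<infinity>" for k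
      using emeasure_compact_finite[OF compact_slab[of e "1 / real (Suc k)"]] by auto
  qed
  also have "measure lborel (\<Inter>k. ?K k) = 0"
  proof -
    have "(\<Inter>k. ?K k) \<subseteq> {x. e \<bullet> x = 0}"
    proof
      fix x assume x: "x \<in> (\<Inter>k. ?K k)"
      have "\<bar>x \<bullet> e\<bar> \<le> 0"
      proof (rule field_le_epsilon)
        fix d :: real assume "d > 0"
        then obtain n where "1 / real (Suc n) < d" using nat_approx_posE by blast
        moreover have "\<bar>x \<bullet> e\<bar> \<le> 1 / real (Suc n)" using x by (auto simp: slab_def)
        ultimately show "\<bar>x \<bullet> e\<bar> \<le> 0 + d" by simp
      qed
      then show "x \<in> {x. e \<bullet> x = 0}" by (simp add: inner_commute)
    qed
    moreover have "negligible {x. e \<bullet> x = 0}"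
      using assms by (intro negligible_hyperplane) auto
    ultimately have "negligible (\<Inter>k. ?K k)" by (rule negligible_subset[rotated])
    then have "measure lebesgue (\<Inter>k. ?K k) = 0" by (simp add: negligible_iff_measure)
    moreover have "(\<Inter>k. ?K k) \<in> sets lborel"
      using borel_compact[OF compact_slab] by auto
    ultimately show ?thesis by (simp add: measure_completion)
  qed
  finally show ?thesis .
qed

lemma subspace_perp: "subspace (perp \<xi>)"
  unfolding perp_def by (simp add: subspace_def inner_add_left)

lemma dim_perp:
  fixes \<xi> :: "'a::euclidean_space"
  assumes "norm \<xi> = 1"
  shows "dim (perp \<xi>) = DIM('a) - 1"
proof -
  have "\<xi> \<noteq> 0" using assms by auto
  then show ?thesis
    using dim_hyperplane[of \<xi>] by (simp add: perp_def inner_commute)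
qed

lemma orthogonal_projection_perp:
  assumes "norm \<xi> = 1"
  shows "orthogonal_projection (perp \<xi>) x = x - (x \<bullet> \<xi>) *\<^sub>R \<xi>"
  unfolding orthogonal_projection_def
proof (rule the_equality)
  have \<xi>: "\<xi> \<bullet> \<xi> = 1" using assms by (simp add: dot_square_norm)
  let ?y = "x - (x \<bullet> \<xi>) *\<^sub>R \<xi>"
  show y: "?y \<in> perp \<xi> \<and> (\<forall>z\<in>perp \<xi>. orthogonal (x - ?y) z)"
    using \<xi> by (auto simp: perp_def orthogonal_def inner_diff_left inner_diff_right inner_commute)
  fix y assume y': "y \<in> perp \<xi> \<and> (\<forall>z\<in>perp \<xi>. orthogonal (x - y) z)"
  then have "y - ?y \<in> perp \<xi>"
    using y subspace_diff[OF subspace_perp] by blast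
  with y y' have "(x - ?y) \<bullet> (y - ?y) = 0" "(x - y) \<bullet> (y - ?y) = 0"
    by (auto simp: orthogonal_def)
  then have "((x - ?y) - (x - y)) \<bullet> (y - ?y) = 0"
    by (simp only: inner_diff_left[of "x - ?y" "x - y"])
  moreover have "(x - ?y) - (x - y) = y - ?y" by (simp add: algebra_simps)
  ultimately have "(y - ?y) \<bullet> (y - ?y) = 0" by (simp only:)
  then show "y = ?y" by simp
qed

lemma orthogonal_projection_perp_image:
  fixes K :: "'a::euclidean_space set"
  assumes \<xi>: "norm \<xi> = 1" and K: "compact K" "convex K" "K \<subseteq> cball 0 1"
  shows "compact (orthogonal_projection (perp \<xi>) ` K)" "convex (orthogonal_projection (perp \<xi>) ` K)"
    "orthogonal_projection (perp \<xi>) ` K \<subseteq> cball 0 1 \<inter> perp \<xi>"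
proof -
  let ?P = "orthogonal_projection (perp \<xi>)"
  have lin: "linear ?P"
    by (rule linearI) (simp_all add: orthogonal_projection_perp[OF \<xi>] inner_add_left algebra_simps)
  show "compact (?P ` K)"
    by (intro compact_continuous_image linear_continuous_on K) (simp add: lin linear_conv_bounded_linear[symmetric])
  show "convex (?P ` K)" by (intro convex_linear_image lin K)
  show "?P ` K \<subseteq> cball 0 1 \<inter> perp \<xi>"
  proof
    fix y assume "y \<in> ?P ` K"
    then obtain x where x: "x \<in> K" "y = x - (x \<bullet> \<xi>) *\<^sub>R \<xi>"
      by (auto simp: orthogonal_projection_perp[OF \<xi>])
    have "\<xi> \<bullet> \<xi> = 1" using \<xi> by (simp add: dot_square_norm)
    then have y: "y \<bullet> \<xi> = 0" "y \<bullet> y = x \<bullet> x - (x \<bullet> \<xi>) * (x \<bullet> \<xi>)"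
      by (simp_all add: x inner_diff_left inner_diff_right inner_commute)
    then have "norm y \<le> norm x" by (simp add: norm_le)
    also have "\<dots> \<le> 1" using x K(3) by auto
    finally show "y \<in> cball 0 1 \<inter> perp \<xi>" using y by (simp add: perp_def)
  qed
qed

text \<open>
  However thin the slab is, its two large faces contribute a fixed amount.  It contains a
  fixed flat cube \<open>Q 0\<close> of codimension one, and the body at distance \<open>t\<close> from it contains the box \<open>Q t\<close>
  over the cube with height \<open>2 t\<close>, whose volume is linear in \<open>t\<close>.  The axis \<open>e\<close> is taken from the
  orthonormal basis that defines \<^term>\<open>lborel_subspace UNIV\<close>, so that boxes along this basis have
  product volume.
\<close>

lemma surface_area_lower_bound:
  "\<exists>e::'a::euclidean_space. norm e = 1 \<and> (\<exists>s>0. \<forall>h>0. s \<le> surface_area UNIV (slab e h))"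
proof -
  have UNIV: "subspace (UNIV :: 'a set)" by simp
  obtain B where B: "B \<subseteq> UNIV" "finite B" "pairwise orthogonal B" "\<forall>b\<in>B. norm b = 1" "span B = (UNIV :: 'a set)" "card B = dim (UNIV :: 'a set)"
    and M: "lborel_subspace (UNIV :: 'a set) = distr (\<Pi>\<^sub>M b\<in>B. lborel) borel (\<lambda>f. \<Sum>b\<in>B. f b *\<^sub>R b)"
    using lborel_subspace_basis[OF UNIV] .
  let ?M = "lborel_subspace (UNIV :: 'a set)"
  interpret subspace_measure UNIV ?M
    by (rule subspace_measure_lborel_subspace[OF UNIV])
  have "card B > 0" using B(6) by simp
  then obtain e where e: "e \<in> B" by (metis card_gt_0_iff ex_in_conv)
  \<comment> \<open>By the triangle inequality, half-side \<open>1 / card B\<close> keeps the cube inside the unit ball.\<close>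
  define a where "a = 1 / real (card B)"
  have a: "a > 0" using \<open>card B > 0\<close> by (simp add: a_def)
  define r where "r t b = (if b = e then t else a)" for t :: real and b
  define Q where "Q t = {x. \<forall>b\<in>B. \<bar>x \<bullet> b\<bar> \<le> r t b}" for t
  define s where "s = 2 * (2 * a) ^ (card B - 1)"
  have s: "s > 0" using a by (simp add: s_def)
  have expand: "x = (\<Sum>b\<in>B. (x \<bullet> b) *\<^sub>R b)" for x
  proof -
    obtain u where u: "x = (\<Sum>b\<in>B. u b *\<^sub>R b)"
      using B(2,5) span_finite[OF B(2)] by auto
    then have "x \<bullet> b = u b" if "b \<in> B" for b
      using inner_orthonormal_sum[OF B(2-4) that] by simp
    then show ?thesis using u by simp
  qed
  have closed_Q: "closed (Q t)" for t
  proof -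
    have "Q t = (\<Inter>b\<in>B. {x. \<bar>x \<bullet> b\<bar> \<le> r t b})" by (auto simp: Q_def)
    then show ?thesis by (auto intro!: closed_INT closed_Collect_le continuous_intros)
  qed
  have vol_Q: "measure ?M (Q t) = s * t" if t: "t \<ge> 0" for t
  proof -
    have "emeasure ?M (Q t) = emeasure (\<Pi>\<^sub>M b\<in>B. lborel) (\<Pi>\<^sub>E b\<in>B. {- r t b..r t b})"
      unfolding M
    proof (subst emeasure_distr[OF orthonormal_sum_measurable])
      show "Q t \<in> sets borel" using closed_Q by (rule borel_closed)
      have "(\<lambda>f. \<Sum>b\<in>B. f b *\<^sub>R b) -` Q t \<inter> space (\<Pi>\<^sub>M b\<in>B. lborel) = (\<Pi>\<^sub>E b\<in>B. {- r t b..r t b})"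
        by (auto simp: Q_def space_PiM PiE_def Pi_def inner_orthonormal_sum[OF B(2-4)] abs_le_iff)
      then show "emeasure (\<Pi>\<^sub>M b\<in>B. lborel) ((\<lambda>f. \<Sum>b\<in>B. f b *\<^sub>R b) -` Q t \<inter> space (\<Pi>\<^sub>M b\<in>B. lborel))
        = emeasure (\<Pi>\<^sub>M b\<in>B. lborel) (\<Pi>\<^sub>E b\<in>B. {- r t b..r t b})" by simp
    qed
    also have "\<dots> = (\<Prod>b\<in>B. emeasure lborel {- r t b..r t b})"
      using B(2) by (intro lborel_product.emeasure_PiM) auto
    also have "\<dots> = (\<Prod>b\<in>B. ennreal (2 * r t b))"
      using t a by (intro prod.cong) (auto simp: r_def)
    also have "\<dots> = ennreal (\<Prod>b\<in>B. 2 * r t b)"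
      using t a by (intro prod_ennreal) (auto simp: r_def)
    also have "(\<Prod>b\<in>B. 2 * r t b) = s * t"
    proof -
      have "(\<Prod>b\<in>B. 2 * r t b) = 2 * r t e * (\<Prod>b\<in>B - {e}. 2 * r t b)"
        using B(2) e by (simp add: prod.remove)
      also have "(\<Prod>b\<in>B - {e}. 2 * r t b) = (\<Prod>b\<in>B - {e}. 2 * a)"
        by (intro prod.cong) (auto simp: r_def)
      also have "\<dots> = (2 * a) ^ (card B - 1)"
        using B(2) e by simp
      finally show ?thesis by (simp add: r_def s_def)
    qed
    finally show ?thesis using s t by (simp add: measure_def)
  qed
  have Q0: "compact (Q 0)" "convex (Q 0)" "\<And>h. h > 0 \<Longrightarrow> Q 0 \<subseteq> slab e h"
  proof -
    have norm_Q0: "norm x \<le> 1" if "x \<in> Q 0" for x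
    proof -
      have "norm x \<le> (\<Sum>b\<in>B. norm ((x \<bullet> b) *\<^sub>R b))"
        by (subst expand) (rule norm_sum)
      also have "\<dots> \<le> (\<Sum>b\<in>B. a)"
        using that a B(4) by (intro sum_mono) (auto simp: Q_def r_def split: if_splits)
      also have "\<dots> = 1" using \<open>card B > 0\<close> by (simp add: a_def)
      finally show ?thesis .
    qed
    then have "bounded (Q 0)" by (auto simp: bounded_iff)
    then show "compact (Q 0)" using closed_Q by (simp add: compact_eq_bounded_closed)
    have "Q 0 = (\<Inter>b\<in>B. {x. b \<bullet> x \<le> r 0 b} \<inter> {x. b \<bullet> x \<ge> - r 0 b})"
      by (auto simp: Q_def inner_commute abs_le_iff minus_le_iff)
    then show "convex (Q 0)"
      by (auto intro!: convex_INT convex_Int convex_halfspace_le convex_halfspace_ge)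
    show "Q 0 \<subseteq> slab e h" if "h > 0" for h
      using norm_Q0 e that by (auto simp: slab_def Q_def r_def)
  qed
  have Q_sub: "Q t \<subseteq> parallel_body UNIV t (Q 0)" if t: "t \<ge> 0" for t
  proof
    fix x assume x: "x \<in> Q t"
    have e1: "e \<bullet> e = 1" using B(4) e by (simp add: dot_square_norm)
    have "x - (x \<bullet> e) *\<^sub>R e \<in> Q 0"
    proof -
      have "\<bar>(x - (x \<bullet> e) *\<^sub>R e) \<bullet> b\<bar> \<le> r 0 b" if "b \<in> B" for b
      proof (cases "b = e")
        case True
        then show ?thesis using e1 by (simp add: r_def inner_diff_left)
      next
        case False
        then have "e \<bullet> b = 0" using B(3) e that by (auto simp: pairwise_def orthogonal_def)
        then show ?thesis using x that False by (auto simp: Q_def r_def inner_diff_left)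
      qed
      then show ?thesis by (simp add: Q_def)
    qed
    moreover have "(x \<bullet> e) *\<^sub>R e \<in> cball 0 t \<inter> UNIV"
      using x e B(4) by (auto simp: Q_def r_def)
    ultimately have "(x - (x \<bullet> e) *\<^sub>R e) + (x \<bullet> e) *\<^sub>R e \<in> parallel_body UNIV t (Q 0)"
      unfolding parallel_body_def by (rule set_plus_intro)
    then show "x \<in> parallel_body UNIV t (Q 0)" by simp
  qed
  have "s \<le> surface_area UNIV (Q 0)"
  proof (rule tendsto_lowerbound[OF surface_area_tendsto[OF UNIV Q0(1,2) subset_UNIV]])
    have "s \<le> (measure ?M (parallel_body UNIV t (Q 0)) - measure ?M (Q 0)) / t" if t: "t > 0" for t
    proof -
      have "s * t = measure ?M (Q t)" using vol_Q t by simp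
      also have "\<dots> \<le> measure ?M (parallel_body UNIV t (Q 0))"
        using Q_sub[of t] t closed_Q[of t]
        by (intro measure_mono_fmeasurable compact_fmeasurable compact_parallel_body Q0)
          (auto simp: sets_eq)
      finally show ?thesis using t vol_Q[of 0] by (simp add: field_simps)
    qed
    then show "\<forall>\<^sub>F t in at_right 0. s \<le> (measure ?M (parallel_body UNIV t (Q 0)) - measure ?M (Q 0)) / t"
      using eventually_at_right_less[of "0::real"] by (auto elim: eventually_mono)
  qed simp
  moreover have "surface_area UNIV (Q 0) \<le> surface_area UNIV (slab e h)" if "h > 0" for h
    by (intro surface_area_mono UNIV Q0 that compact_slab convex_slab subset_UNIV)
  ultimately have "\<forall>h>0. s \<le> surface_area UNIV (slab e h)"
    using order_trans by blast
  then show ?thesis using s e B(4) by blast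
qed

text \<open>
  Only the thickness of the slab remains to be chosen: its volume tends to \<open>0\<close> with the thickness,
  while both maxima equal the surface area of the unit ball of dimension \<open>n - 1\<close>.
\<close>

theorem theorem4p1:
  fixes \<alpha> :: real
  assumes "CARD('n::finite) \<ge> 2" and "\<alpha> > 0"
  shows "\<exists>K :: (real ^ 'n) set. convex_body K \<and> centrally_symmetric K \<and>
    (\<exists>M N.
      is_maximum (\<lambda>\<xi>. surface_area (perp \<xi>) (orthogonal_projection (perp \<xi>) ` K)) (sphere 0 1) M \<and>
      is_maximum (\<lambda>\<xi>. surface_area (perp \<xi>) (K \<inter> perp \<xi>)) (sphere 0 1) N \<and>
      surface_area UNIV K > \<alpha> * measure lborel K powr (1 / real CARD('n)) * M \<and>
      \<alpha> * measure lborel K powr (1 / real CARD('n)) * M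
        \<ge> \<alpha> * measure lborel K powr (1 / real CARD('n)) * N)"
proof -
  obtain e :: "real ^ 'n" and s where e: "norm e = 1" and s: "s > 0" "\<And>h. h > 0 \<Longrightarrow> s \<le> surface_area UNIV (slab e h)"
    using surface_area_lower_bound by blast
  define m where "m = CARD('n) - 1"
  define M where "M = real m * unit_ball_vol (real m)"
  have disc: "surface_area (perp \<xi>) (cball 0 1 \<inter> perp \<xi>) = M" if "norm \<xi> = 1" for \<xi> :: "real ^ 'n"
  proof -
    have "dim (perp \<xi>) = m" using dim_perp[OF that] by (simp add: m_def)
    then show ?thesis using surface_area_unit_cball[OF subspace_perp[of \<xi>]] by (simp add: M_def)
  qed
  have "(\<lambda>k. \<alpha> * measure lborel (slab e (1 / real (Suc k))) powr (1 / real CARD('n)) * M)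
    \<longlonglongrightarrow> \<alpha> * 0 powr (1 / real CARD('n)) * M"
    by (intro tendsto_mult tendsto_const tendsto_powr' measure_slab_tendsto_0 e) auto
  then have "\<forall>\<^sub>F k in sequentially. \<alpha> * measure lborel (slab e (1 / real (Suc k))) powr (1 / real CARD('n)) * M < s"
    using s(1) by (intro order_tendstoD(2)) auto
  then obtain k where k: "\<alpha> * measure lborel (slab e (1 / real (Suc k))) powr (1 / real CARD('n)) * M < s"
    by (auto simp: eventually_sequentially)
  define h where "h = 1 / real (Suc k)"
  have h: "h > 0" by (simp add: h_def)
  let ?K = "slab e h" and ?P = "\<lambda>\<xi>. orthogonal_projection (perp \<xi>)"
  have K: "compact ?K" "convex ?K" "?K \<subseteq> cball 0 1"
    by (auto simp: compact_slab convex_slab) (auto simp: slab_def)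
  have le_M: "surface_area (perp \<xi>) A \<le> M"
    if "norm \<xi> = 1" "compact A" "convex A" "A \<subseteq> cball 0 1 \<inter> perp \<xi>" for \<xi> and A :: "(real ^ 'n) set"
  proof -
    have "compact (cball 0 1 \<inter> perp \<xi>)" "convex (cball 0 1 \<inter> perp \<xi>)"
      by (intro compact_Int_closed compact_cball closed_subspace subspace_perp)
        (intro convex_Int convex_cball subspace_imp_convex subspace_perp)
    then have "surface_area (perp \<xi>) A \<le> surface_area (perp \<xi>) (cball 0 1 \<inter> perp \<xi>)"
      using that by (intro surface_area_mono subspace_perp) auto
    then show ?thesis by (simp add: disc[OF that(1)])
  qed
  have section_e: "?K \<inter> perp e = cball 0 1 \<inter> perp e"
    using h by (auto simp: slab_def perp_def)
  have projection_e: "?P e ` ?K = cball 0 1 \<inter> perp e"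
  proof
    show "?P e ` ?K \<subseteq> cball 0 1 \<inter> perp e"
      by (rule orthogonal_projection_perp_image[OF e K])
    show "cball 0 1 \<inter> perp e \<subseteq> ?P e ` ?K"
    proof
      fix x assume x: "x \<in> cball 0 1 \<inter> perp e"
      then have "x \<bullet> e = 0" by (simp add: perp_def)
      then have "x = ?P e x" by (simp add: orthogonal_projection_perp[OF e])
      moreover have "x \<in> ?K" using x section_e by blast
      ultimately show "x \<in> ?P e ` ?K" by blast
    qed
  qed
  have "is_maximum (\<lambda>\<xi>. surface_area (perp \<xi>) (?P \<xi> ` ?K)) (sphere 0 1) M"
    unfolding is_maximum_def
  proof
    show "M \<in> (\<lambda>\<xi>. surface_area (perp \<xi>) (?P \<xi> ` ?K)) ` sphere 0 1"
      by (rule image_eqI[of _ _ e]) (simp_all add: projection_e disc e)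
    show "\<forall>\<xi>\<in>sphere 0 1. surface_area (perp \<xi>) (?P \<xi> ` ?K) \<le> M"
    proof
      fix \<xi> :: "real ^ 'n" assume "\<xi> \<in> sphere 0 1"
      then have "norm \<xi> = 1" by simp
      with orthogonal_projection_perp_image[OF this K] le_M show "surface_area (perp \<xi>) (?P \<xi> ` ?K) \<le> M"
        by blast
    qed
  qed
  moreover have "is_maximum (\<lambda>\<xi>. surface_area (perp \<xi>) (?K \<inter> perp \<xi>)) (sphere 0 1) M"
    unfolding is_maximum_def
  proof
    show "M \<in> (\<lambda>\<xi>. surface_area (perp \<xi>) (?K \<inter> perp \<xi>)) ` sphere 0 1"
      by (rule image_eqI[of _ _ e]) (simp_all add: section_e disc e)
    show "\<forall>\<xi>\<in>sphere 0 1. surface_area (perp \<xi>) (?K \<inter> perp \<xi>) \<le> M"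
      using K(3)
      by (intro ballI le_M compact_Int_closed[OF K(1) closed_subspace[OF subspace_perp]]
          convex_Int[OF K(2) subspace_imp_convex[OF subspace_perp]]) auto
  qed
  moreover have "\<alpha> * measure lborel ?K powr (1 / real CARD('n)) * M < surface_area UNIV ?K"
    using k s(2)[OF h] by (simp add: h_def)
  moreover have "convex_body ?K" using e h by (rule convex_body_slab)
  moreover have "centrally_symmetric ?K" by (auto simp: centrally_symmetric_def slab_def)
  ultimately show ?thesis by blast
qed

end
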